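(* Let $\varphi$ be a smooth positive function of the length. Let $t\mapsto c(t,\cdot)$ be a smooth path in $Imm(S^1,\mathbb{R}^2)$ with $c_t\cdot c_\theta=0$, and write $c_t=i\,a\,c_\theta/|c_\theta|$ with $a=a(t,\theta)$ real-valued. Then the path represents a geodesic in $B_i(S^1,\mathbb{R}^2)$ for the metric $G^\varphi$ if and only if $$a_t=\frac{\kappa_c}{2}\left(a^2-\frac{\varphi'(\ell)}{\varphi(\ell)}\int_{S^1}a^2|c_\theta|\,d\theta\right)+\frac{\varphi'(\ell)}{\varphi(\ell)}\,a\int_{S^1}a\kappa_c|c_\theta|\,d\theta .$$ In particular, with $\overline{f}=\frac1\ell\int_{S^1}f|c_\theta|\,d\theta$ denoting the average of a function $f(t,\theta)$, the geodesic equation is $$a_t=\frac{\kappa_c}{2}\left(a^2-\overline{a^2}\right)+a\cdot\overline{a\kappa_c}\quad\text{if }\varphi(\ell)=\ell,$$ $$a_t=\frac{\kappa_c}{2}\left(a^2-(A\ell)\overline{a^2}\right)+(A\ell)\,a\cdot\overline{a\kappa_c}\quad\text{if }\varphi(\ell)=e^{A\ell}.$$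
   Context: $Imm(S^1,\mathbb{R}^2)$ is the space of $C^\infty$ immersions $S^1\to\mathbb{R}^2$, $B_i(S^1,\mathbb{R}^2)=Imm(S^1,\mathbb{R}^2)/Diff(S^1)$ is its quotient by reparametrization, and $\mathbb{R}^2$ is identified with $\mathbb{C}$. Subscripts $t,\theta$ denote partial derivatives; $\ell=\ell(c)=\int_{S^1}|c_\theta|\,d\theta$; $\varphi'=d\varphi/d\ell$; $n_c=ic_\theta/|c_\theta|$; the curvature $\kappa_c$ is defined by $\left(\frac{c_\theta}{|c_\theta|}\right)_\theta=i\kappa_cc_\theta=\kappa_c|c_\theta|n_c$. In the exponential case $A>0$ is a constant. The metric on $Imm(S^1,\mathbb{R}^2)$ is $$G^{\varphi}_c(h,k)=\varphi(\ell(c))\int_{S^1}(h\cdot k)\,|c_\theta|\,d\theta,\qquad h,k\in C^\infty(S^1,\mathbb{R}^2),$$ and on $B_i(S^1,\mathbb{R}^2)$ one uses the induced quotient metric, obtained by applying $G^\varphi_c$ to the normal components $h^\perp=(h\cdot n_c)n_c$. Geodesics in $B_i(S^1,\mathbb{R}^2)$ are represented by the horizontal paths ($c_t\cdot c_\theta=0$) in $Imm(S^1,\mathbb{R}^2)$ that are geodesics of $G^\varphi$ there, i.e. critical points, under smooth variations with fixed endpoints, of the energy $\frac12\int_a^bG^\varphi_c(c_t,c_t)\,dt$. *)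

theory Defs
  imports "HOL-Analysis.Analysis"
begin

(* Differentiability is taken within S, so that one-sided derivatives are used at the
   boundary of a closed time interval.  All sets S used below are convex with nonempty
   interior, so that the derivative f' is unique on S. *)
primrec Ck_on :: "nat \<Rightarrow> 'a::euclidean_space set \<Rightarrow> ('a \<Rightarrow> 'b::real_normed_vector) \<Rightarrow> bool" where
  "Ck_on 0 S f \<longleftrightarrow> continuous_on S f"
| "Ck_on (Suc k) S f \<longleftrightarrow>
     (\<exists>f'. (\<forall>x\<in>S. (f has_derivative f' x) (at x within S)) \<and> (\<forall>v. Ck_on k S (\<lambda>x. f' x v)))"

definition smooth_on :: "'a::euclidean_space set \<Rightarrow> ('a \<Rightarrow> 'b::real_normed_vector) \<Rightarrow> bool" where
  "smooth_on S f \<longleftrightarrow> (\<forall>k. Ck_on k S f)"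

(* The circle is R/(2 pi Z) with coordinate theta, and the plane is the type complex:
   a map from the circle is a function on the reals with period 2 pi. *)
definition Imm :: "(real \<Rightarrow> complex) set" where
  "Imm = {c. smooth_on UNIV c \<and> (\<forall>\<theta>. c (\<theta> + 2 * pi) = c \<theta>) \<and>
             (\<forall>\<theta>. vector_derivative c (at \<theta>) \<noteq> 0)}"

definition circle_integral :: "(real \<Rightarrow> real) \<Rightarrow> real" where
  "circle_integral f = integral {0..2 * pi} f"

definition speed :: "(real \<Rightarrow> complex) \<Rightarrow> real \<Rightarrow> real" where
  "speed c \<theta> = norm (vector_derivative c (at \<theta>))"

definition unit_tangent :: "(real \<Rightarrow> complex) \<Rightarrow> real \<Rightarrow> complex" where
  "unit_tangent c \<theta> = vector_derivative c (at \<theta>) / of_real (speed c \<theta>)"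

definition curve_length :: "(real \<Rightarrow> complex) \<Rightarrow> real" where
  "curve_length c = circle_integral (speed c)"

definition curvature :: "(real \<Rightarrow> complex) \<Rightarrow> real \<Rightarrow> real" where
  "curvature c \<theta> =
     (THE \<kappa>. vector_derivative (unit_tangent c) (at \<theta>)
            = \<i> * of_real \<kappa> * vector_derivative c (at \<theta>))"

definition average :: "(real \<Rightarrow> complex) \<Rightarrow> (real \<Rightarrow> real) \<Rightarrow> real" where
  "average c f = 1 / curve_length c * circle_integral (\<lambda>\<theta>. f \<theta> * speed c \<theta>)"

definition metric :: "(real \<Rightarrow> real) \<Rightarrow> (real \<Rightarrow> complex) \<Rightarrow> (real \<Rightarrow> complex) \<Rightarrow> (real \<Rightarrow> complex) \<Rightarrow> real" where
  "metric \<phi> c h k = \<phi> (curve_length c) * circle_integral (\<lambda>\<theta>. (h \<theta> \<bullet> k \<theta>) * speed c \<theta>)"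

(* A path on [t0, t1] is a function c with c t theta relevant only for t in [t0, t1].
   Smoothness of a path in Imm means joint smoothness in (t, theta). *)
definition smooth_Imm_path :: "real \<Rightarrow> real \<Rightarrow> (real \<Rightarrow> real \<Rightarrow> complex) \<Rightarrow> bool" where
  "smooth_Imm_path t0 t1 c \<longleftrightarrow>
     smooth_on ({t0..t1} \<times> UNIV) (\<lambda>(t, \<theta>). c t \<theta>) \<and> (\<forall>t\<in>{t0..t1}. c t \<in> Imm)"

definition velocity :: "real \<Rightarrow> real \<Rightarrow> (real \<Rightarrow> real \<Rightarrow> complex) \<Rightarrow> real \<Rightarrow> real \<Rightarrow> complex" where
  "velocity t0 t1 c t \<theta> = vector_derivative (\<lambda>\<tau>. c \<tau> \<theta>) (at t within {t0..t1})"

definition horizontal :: "real \<Rightarrow> real \<Rightarrow> (real \<Rightarrow> real \<Rightarrow> complex) \<Rightarrow> bool" where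
  "horizontal t0 t1 c \<longleftrightarrow>
     (\<forall>t\<in>{t0..t1}. \<forall>\<theta>. velocity t0 t1 c t \<theta> \<bullet> vector_derivative (c t) (at \<theta>) = 0)"

definition energy :: "(real \<Rightarrow> real) \<Rightarrow> real \<Rightarrow> real \<Rightarrow> (real \<Rightarrow> real \<Rightarrow> complex) \<Rightarrow> real" where
  "energy \<phi> t0 t1 c =
     1 / 2 * integral {t0..t1} (\<lambda>t. metric \<phi> (c t) (velocity t0 t1 c t) (velocity t0 t1 c t))"

definition smooth_variation ::
  "real \<Rightarrow> real \<Rightarrow> (real \<Rightarrow> real \<Rightarrow> complex) \<Rightarrow> real \<Rightarrow> (real \<Rightarrow> real \<Rightarrow> real \<Rightarrow> complex) \<Rightarrow> bool" where
  "smooth_variation t0 t1 c \<epsilon> V \<longleftrightarrow>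
     smooth_on ({-\<epsilon><..<\<epsilon>} \<times> {t0..t1} \<times> UNIV) (\<lambda>(s, t, \<theta>). V s t \<theta>) \<and>
     (\<forall>s\<in>{-\<epsilon><..<\<epsilon>}. smooth_Imm_path t0 t1 (V s)) \<and>
     (\<forall>t\<in>{t0..t1}. V 0 t = c t) \<and>
     (\<forall>s\<in>{-\<epsilon><..<\<epsilon>}. V s t0 = c t0 \<and> V s t1 = c t1)"

definition geodesic_in_Imm :: "(real \<Rightarrow> real) \<Rightarrow> real \<Rightarrow> real \<Rightarrow> (real \<Rightarrow> real \<Rightarrow> complex) \<Rightarrow> bool" where
  "geodesic_in_Imm \<phi> t0 t1 c \<longleftrightarrow>
     smooth_Imm_path t0 t1 c \<and>
     (\<forall>\<epsilon>>0. \<forall>V. smooth_variation t0 t1 c \<epsilon> V \<longrightarrow>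
        ((\<lambda>s. energy \<phi> t0 t1 (V s)) has_real_derivative 0) (at 0))"

(* Geodesics of the quotient metric on B_i = Imm / Diff(S^1) are, by convention, those
   represented by horizontal geodesics upstairs.  On horizontal velocities the normal part
   is the velocity itself, so the quotient metric agrees there with the one on Imm. *)
definition represents_geodesic_in_Bi ::
  "(real \<Rightarrow> real) \<Rightarrow> real \<Rightarrow> real \<Rightarrow> (real \<Rightarrow> real \<Rightarrow> complex) \<Rightarrow> bool" where
  "represents_geodesic_in_Bi \<phi> t0 t1 c \<longleftrightarrow> horizontal t0 t1 c \<and> geodesic_in_Imm \<phi> t0 t1 c"

end

theory Submission
  imports Defs
begin

text \<open>
  Write \<open>T = c\<^sub>\<theta> / |c\<^sub>\<theta>|\<close> for the unit tangent, so that a horizontal path satisfies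
  \<open>c\<^sub>t = a \<i> T\<close>.  For a variation with fixed endpoints and variation field \<open>W\<close>, the
  derivative of the energy is the time integral of

    \<open>\<phi>'(\<ell>)/2 \<integral>W\<^sub>\<theta> \<bullet> T d\<theta> \<integral>a\<^sup>2 |c\<^sub>\<theta>| d\<theta> + \<phi>(\<ell>) \<integral>(a (\<i> c\<^sub>\<theta>) \<bullet> W\<^sub>t + a\<^sup>2/2 W\<^sub>\<theta> \<bullet> T) d\<theta>\<close>.

  Integrating \<open>W\<^sub>t\<close> by parts in time and \<open>W\<^sub>\<theta>\<close> by parts on the circle turns it into

    \<open>\<phi>(\<ell>) \<integral>(W \<bullet> \<i> c\<^sub>\<theta>) (R - a\<^sub>t) d\<theta>\<close>,

  where \<open>R\<close> is the right-hand side of the geodesic equation: the tangential component of \<open>W\<close>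
  drops out because \<open>c\<^sub>t\<close> is normal.  Hence the path is critical if and only if \<open>R = a\<^sub>t\<close>.

  Both integrations by parts are organised so that the order of the two integrals is never
  exchanged.  The time derivative is that of the single function
  \<open>Q(t) = \<phi>(\<ell>) \<integral>a (W \<bullet> \<i> c\<^sub>\<theta>) d\<theta>\<close>, which vanishes at both endpoints; for fixed time, what
  remains is the \<open>\<theta>\<close>-derivative of a periodic function (\<open>first_variation\<close>).  That the
  energy may be differentiated under both integrals is \<open>energy_has_derivative\<close>, and the two are
  combined in \<open>energy_variation\<close>, where \<open>W\<^sub>t\<close> and \<open>W\<^sub>\<theta>\<close> are recognised among the
  second derivatives of the variation by \<open>mixed_partials_commute\<close>.

  For the direction from criticality to the equation it is enough to vary \<open>c\<close> along
  \<open>(t - t0) (t1 - t) p(t) q(cos \<theta>, sin \<theta>) v\<close> with polynomials \<open>p\<close>, \<open>q\<close> and a constant vector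
  \<open>v\<close> (\<open>test_variation\<close>).  These fields are smooth for reasons independent of \<open>c\<close>,
  and by the Stone-Weierstrass theorem there are enough of them to detect the zero function
  (\<open>fundamental_lemma\<close>), so no smooth bump functions enter.  The two special cases follow
  by inserting \<open>\<phi>'/\<phi> = 1/\<ell>\<close> and \<open>\<phi>'/\<phi> = A\<close>.
\<close>

section \<open>Smooth maps: closure properties and partial derivatives\<close>

lemma Ck_on_SucI:
  assumes "\<And>x. x \<in> S \<Longrightarrow> (f has_derivative f' x) (at x within S)" "\<And>v. Ck_on k S (\<lambda>x. f' x v)"
  shows "Ck_on (Suc k) S f"
  using assms by auto

lemma Ck_on_SucE:
  assumes "Ck_on (Suc k) S f"
  obtains f' where "\<And>x. x \<in> S \<Longrightarrow> (f has_derivative f' x) (at x within S)" "\<And>v. Ck_on k S (\<lambda>x. f' x v)"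
  using assms by auto

lemma Ck_on_Suc_imp: "Ck_on (Suc k) S f \<Longrightarrow> Ck_on k S f"
proof (induction k arbitrary: f)
  case 0
  then show ?case
    by (auto simp: continuous_on_eq_continuous_within intro: has_derivative_continuous)
next
  case (Suc k)
  from Suc.prems obtain f' where
    "\<And>x. x \<in> S \<Longrightarrow> (f has_derivative f' x) (at x within S)" "\<And>v. Ck_on (Suc k) S (\<lambda>x. f' x v)"
    by (rule Ck_on_SucE) blast
  with Suc.IH show ?case by (intro Ck_on_SucI[where f' = f']) auto
qed

lemma Ck_on_imp_continuous: "Ck_on k S f \<Longrightarrow> continuous_on S f"
  by (induction k) (auto dest: Ck_on_Suc_imp simp del: Ck_on.simps(2))

lemma Ck_on_const: "Ck_on k S (\<lambda>_. c)"
proof (induction k arbitrary: c)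
  case (Suc k)
  then show ?case by (intro Ck_on_SucI[where f' = "\<lambda>_ _. 0"]) auto
qed auto

lemma Ck_on_bounded_linear: "bounded_linear f \<Longrightarrow> Ck_on k S f"
proof (cases k)
  case (Suc j)
  assume f: "bounded_linear f"
  show ?thesis unfolding Suc
    by (rule Ck_on_SucI[where f' = "\<lambda>_. f"])
      (auto simp: Ck_on_const bounded_linear_imp_has_derivative[OF f])
qed (auto intro: linear_continuous_on)

lemma Ck_on_add: "Ck_on k S f \<Longrightarrow> Ck_on k S g \<Longrightarrow> Ck_on k S (\<lambda>x. f x + g x)"
proof (induction k arbitrary: f g)
  case (Suc k)
  from Suc.prems(1) obtain f' where
    f: "\<And>x. x \<in> S \<Longrightarrow> (f has_derivative f' x) (at x within S)" "\<And>v. Ck_on k S (\<lambda>x. f' x v)"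
    by (rule Ck_on_SucE) blast
  from Suc.prems(2) obtain g' where
    g: "\<And>x. x \<in> S \<Longrightarrow> (g has_derivative g' x) (at x within S)" "\<And>v. Ck_on k S (\<lambda>x. g' x v)"
    by (rule Ck_on_SucE) blast
  show ?case
    by (rule Ck_on_SucI[where f' = "\<lambda>x v. f' x v + g' x v"])
      (auto intro!: f g Suc.IH has_derivative_add)
qed (auto intro: continuous_intros)

text \<open>By the product rule, each derivative of the product is a sum of two products of functions
  of the same kind, so the induction runs over all pairs of factors at once.\<close>
lemma Ck_on_bilinear:
  assumes "bounded_bilinear bl"
  shows "Ck_on k S f \<Longrightarrow> Ck_on k S g \<Longrightarrow> Ck_on k S (\<lambda>x. bl (f x) (g x))"
proof (induction k arbitrary: f g)
  case 0
  then show ?case by (auto intro: bounded_bilinear.continuous_on[OF assms])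
next
  case (Suc k)
  from Suc.prems(1) obtain f' where
    f: "\<And>x. x \<in> S \<Longrightarrow> (f has_derivative f' x) (at x within S)" "\<And>v. Ck_on k S (\<lambda>x. f' x v)"
    by (rule Ck_on_SucE) blast
  from Suc.prems(2) obtain g' where
    g: "\<And>x. x \<in> S \<Longrightarrow> (g has_derivative g' x) (at x within S)" "\<And>v. Ck_on k S (\<lambda>x. g' x v)"
    by (rule Ck_on_SucE) blast
  show ?case
    by (rule Ck_on_SucI[where f' = "\<lambda>x v. bl (f x) (g' x v) + bl (f' x v) (g x)"])
      (auto intro!: f g Suc.IH Ck_on_add Suc.prems[THEN Ck_on_Suc_imp]
          bounded_bilinear.FDERIV[OF assms])
qed

text \<open>Affine precomposition transports smoothness from functions of time, of the curve parameter
  or of both to functions of all three variables of a variation.\<close>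
lemma Ck_on_compose_affine:
  assumes L: "bounded_linear L" and "\<And>x. x \<in> S' \<Longrightarrow> b + L x \<in> S"
  shows "Ck_on k S f \<Longrightarrow> Ck_on k S' (\<lambda>x. f (b + L x))"
proof (induction k arbitrary: f)
  case 0
  have "continuous_on S' (\<lambda>x. b + L x)"
    by (intro continuous_on_add continuous_on_const linear_continuous_on L)
  then show ?case using 0 assms(2)
    by (auto intro: continuous_on_compose2[of S f S' "\<lambda>x. b + L x"])
next
  case (Suc k)
  from Suc.prems(1) obtain f' where
    f: "\<And>x. x \<in> S \<Longrightarrow> (f has_derivative f' x) (at x within S)" "\<And>v. Ck_on k S (\<lambda>x. f' x v)"
    by (rule Ck_on_SucE) blast
  show ?case
  proof (rule Ck_on_SucI[where f' = "\<lambda>x v. f' (b + L x) (L v)"])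
    fix x assume x: "x \<in> S'"
    have "((\<lambda>x. b + L x) has_derivative L) (at x within S')"
      by (auto intro!: derivative_eq_intros bounded_linear_imp_has_derivative[OF L])
    moreover have "(f has_derivative f' (b + L x)) (at (b + L x) within (\<lambda>x. b + L x) ` S')"
      using assms(2) x by (intro has_derivative_subset[OF f(1)]) auto
    ultimately show "((\<lambda>x. f (b + L x)) has_derivative (\<lambda>v. f' (b + L x) (L v))) (at x within S')"
      by (rule has_derivative_in_compose)
  qed (intro Suc.IH f)
qed

lemma Ck_on_compose_linear:
  "bounded_linear L \<Longrightarrow> Ck_on k UNIV f \<Longrightarrow> Ck_on k S (\<lambda>x. f (L x))"
  using Ck_on_compose_affine[of L S 0 UNIV k f] by simp

lemma Ck_on_cos_sin: "Ck_on k (UNIV :: real set) cos \<and> Ck_on k (UNIV :: real set) sin"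
proof (induction k)
  case (Suc k)
  have "Ck_on k UNIV (\<lambda>x :: real. - sin x * v)" "Ck_on k UNIV (\<lambda>x :: real. cos x * v)" for v
    using Suc Ck_on_bilinear[OF bounded_bilinear_mult, of k UNIV sin "\<lambda>_. -v"]
      Ck_on_bilinear[OF bounded_bilinear_mult, of k UNIV cos "\<lambda>_. v"]
    by (auto simp: Ck_on_const)
  then show ?case
    by (intro conjI Ck_on_SucI[where f' = "\<lambda>x v. - sin x * v"] Ck_on_SucI[where f' = "\<lambda>x v. cos x * v"])
      (auto intro!: derivative_eq_intros)
qed (auto intro: continuous_intros)

text \<open>The constant factor makes the class closed under differentiation.\<close>
lemma Ck_on_exp: "Ck_on k (S :: real set) (\<lambda>x. c * exp (A * x))" for A c :: real
proof (induction k arbitrary: c)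
  case (Suc k)
  have "Ck_on k S (\<lambda>x. c * exp (A * x) * (A * v))" for v
    using Suc[of "c * A * v"] by (simp add: algebra_simps)
  then show ?case
    by (intro Ck_on_SucI[where f' = "\<lambda>x v. c * exp (A * x) * (A * v)"])
      (auto intro!: derivative_eq_intros)
qed (auto intro!: continuous_intros)

lemma Ck_on_partials_fst:
  assumes "(f has_derivative f') (at (x, y) within A \<times> B)" "x \<in> A" "y \<in> B"
  shows "((\<lambda>u. f (u, y)) has_vector_derivative f' (1, 0)) (at x within A)"
proof -
  have "((\<lambda>u. (u, y)) has_derivative (\<lambda>u. (u, 0))) (at x within A)"
    by (auto intro!: derivative_eq_intros)
  moreover have "(f has_derivative f') (at (x, y) within (\<lambda>u. (u, y)) ` A)"
    by (rule has_derivative_subset[OF assms(1)]) (use assms in auto)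
  ultimately have "((\<lambda>u. f (u, y)) has_derivative (\<lambda>u. f' (u, 0))) (at x within A)"
    by (rule has_derivative_in_compose)
  moreover have "f' (u, 0) = u *\<^sub>R f' (1, 0)" for u :: real
  proof -
    have "f' (u *\<^sub>R (1, 0)) = u *\<^sub>R f' (1, 0)"
      by (intro linear_scale has_derivative_linear[OF assms(1)])
    then show ?thesis by simp
  qed
  then have "(\<lambda>u. f' (u, 0)) = (\<lambda>u. u *\<^sub>R f' (1, 0))" by blast
  ultimately show ?thesis unfolding has_vector_derivative_def by simp
qed

lemma Ck_on_partials_snd:
  assumes "(f has_derivative f') (at (x, y) within A \<times> B)" "x \<in> A" "y \<in> B"
  shows "((\<lambda>u. f (x, u)) has_derivative (\<lambda>u. f' (0, u))) (at y within B)"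
proof -
  have "((\<lambda>u. (x, u)) has_derivative (\<lambda>u. (0, u))) (at y within B)"
    by (auto intro!: derivative_eq_intros)
  moreover have "(f has_derivative f') (at (x, y) within (\<lambda>u. (x, u)) ` B)"
    by (rule has_derivative_subset[OF assms(1)]) (use assms in auto)
  ultimately show ?thesis
    by (rule has_derivative_in_compose)
qed

text \<open>Along a coordinate line the total derivative restricts to an ordinary derivative in one
  variable, one-sided where the line ends.  Later arguments run entirely on such derivatives, whose
  uniqueness at boundary points is elementary.\<close>
lemma Ck_on_partials2:
  fixes f :: "real \<times> real \<Rightarrow> 'b::real_normed_vector"
  assumes "Ck_on (Suc k) (A \<times> B) f"
  obtains f1 f2 where "Ck_on k (A \<times> B) f1" "Ck_on k (A \<times> B) f2"
    "\<And>x y. x \<in> A \<Longrightarrow> y \<in> B \<Longrightarrow> ((\<lambda>u. f (u, y)) has_vector_derivative f1 (x, y)) (at x within A)"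
    "\<And>x y. x \<in> A \<Longrightarrow> y \<in> B \<Longrightarrow> ((\<lambda>u. f (x, u)) has_vector_derivative f2 (x, y)) (at y within B)"
proof -
  from assms obtain f' where
    f: "\<And>z. z \<in> A \<times> B \<Longrightarrow> (f has_derivative f' z) (at z within A \<times> B)"
       "\<And>v. Ck_on k (A \<times> B) (\<lambda>z. f' z v)"
    by (rule Ck_on_SucE) blast
  have "((\<lambda>u. f (x, u)) has_vector_derivative f' (x, y) (0, 1)) (at y within B)"
    if "x \<in> A" "y \<in> B" for x y
  proof -
    have "f' (x, y) (0, u) = u *\<^sub>R f' (x, y) (0, 1)" for u :: real
      using linear_scale[OF has_derivative_linear[OF f(1)[of "(x, y)"]], of u "(0, 1)"] that by simp
    then have eq: "(\<lambda>u. f' (x, y) (0, u)) = (\<lambda>u. u *\<^sub>R f' (x, y) (0, 1))" by blast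
    show ?thesis
      using Ck_on_partials_snd[OF f(1)[of "(x, y)"]] that
      unfolding has_vector_derivative_def eq by simp
  qed
  then show thesis
    using that[OF f(2)[of "(1, 0)"] f(2)[of "(0, 1)"]] Ck_on_partials_fst[OF f(1)] by auto
qed

lemma Ck_on_partials3:
  fixes f :: "real \<times> real \<times> real \<Rightarrow> 'b::real_normed_vector"
  assumes "Ck_on (Suc k) (A \<times> B \<times> C) f"
  obtains f1 f2 f3 where
    "Ck_on k (A \<times> B \<times> C) f1" "Ck_on k (A \<times> B \<times> C) f2" "Ck_on k (A \<times> B \<times> C) f3"
    "\<And>x y z. x \<in> A \<Longrightarrow> y \<in> B \<Longrightarrow> z \<in> C \<Longrightarrow>
        ((\<lambda>u. f (u, y, z)) has_vector_derivative f1 (x, y, z)) (at x within A)"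
    "\<And>x y z. x \<in> A \<Longrightarrow> y \<in> B \<Longrightarrow> z \<in> C \<Longrightarrow>
        ((\<lambda>u. f (x, u, z)) has_vector_derivative f2 (x, y, z)) (at y within B)"
    "\<And>x y z. x \<in> A \<Longrightarrow> y \<in> B \<Longrightarrow> z \<in> C \<Longrightarrow>
        ((\<lambda>u. f (x, y, u)) has_vector_derivative f3 (x, y, z)) (at z within C)"
proof -
  from assms obtain f' where
    f: "\<And>w. w \<in> A \<times> B \<times> C \<Longrightarrow> (f has_derivative f' w) (at w within A \<times> B \<times> C)"
       "\<And>v. Ck_on k (A \<times> B \<times> C) (\<lambda>w. f' w v)"
    by (rule Ck_on_SucE) blast
  have 1: "((\<lambda>u. f (u, y, z)) has_vector_derivative f' (x, y, z) (1, 0, 0)) (at x within A)"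
    if "x \<in> A" "y \<in> B" "z \<in> C" for x y z
    using Ck_on_partials_fst[OF f(1)[of "(x, y, z)"]] that by (simp add: zero_prod_def)
  have yz: "((\<lambda>w. f (x, w)) has_derivative (\<lambda>w. f' (x, y, z) (0, w))) (at (y, z) within B \<times> C)"
    if "x \<in> A" "y \<in> B" "z \<in> C" for x y z
    using Ck_on_partials_snd[OF f(1)[of "(x, y, z)"]] that by simp
  have 2: "((\<lambda>u. f (x, u, z)) has_vector_derivative f' (x, y, z) (0, 1, 0)) (at y within B)"
    if "x \<in> A" "y \<in> B" "z \<in> C" for x y z
    using Ck_on_partials_fst[OF yz[OF that]] that by simp
  have 3: "((\<lambda>u. f (x, y, u)) has_vector_derivative f' (x, y, z) (0, 0, 1)) (at z within C)"
    if "x \<in> A" "y \<in> B" "z \<in> C" for x y z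
  proof -
    have "f' (x, y, z) (0, 0, u) = u *\<^sub>R f' (x, y, z) (0, 0, 1)" for u :: real
      using linear_scale[OF has_derivative_linear[OF f(1)[of "(x, y, z)"]], of u "(0, 0, 1)"] that by simp
    then have eq: "(\<lambda>u. f' (x, y, z) (0, 0, u)) = (\<lambda>u. u *\<^sub>R f' (x, y, z) (0, 0, 1))" by blast
    show ?thesis
      using Ck_on_partials_snd[OF yz[OF that]] that
      unfolding has_vector_derivative_def eq by simp
  qed
  show thesis
    by (rule that[OF f(2)[of "(1, 0, 0)"] f(2)[of "(0, 1, 0)"] f(2)[of "(0, 0, 1)"]]) (fact 1 2 3)+
qed

lemma Ck_on_partial1:
  fixes f :: "real \<Rightarrow> 'b::real_normed_vector"
  assumes "Ck_on (Suc k) S f"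
  obtains f' where "Ck_on k S f'" "\<And>x. x \<in> S \<Longrightarrow> (f has_vector_derivative f' x) (at x within S)"
proof -
  from assms obtain f' where
    f: "\<And>x. x \<in> S \<Longrightarrow> (f has_derivative f' x) (at x within S)" "\<And>v. Ck_on k S (\<lambda>x. f' x v)"
    by (rule Ck_on_SucE) blast
  have "(f has_vector_derivative f' x 1) (at x within S)" if "x \<in> S" for x
  proof -
    have "f' x u = u *\<^sub>R f' x 1" for u :: real
      using linear_scale[OF has_derivative_linear[OF f(1)[OF that]], of u 1] by simp
    then have eq: "f' x = (\<lambda>u. u *\<^sub>R f' x 1)" by blast
    show ?thesis unfolding has_vector_derivative_def using f(1)[OF that] by (subst (asm) eq)
  qed
  then show thesis using that f(2) by blast
qed

section \<open>Parametric integrals, mixed partial derivatives and the moving frame\<close>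

lemma continuous_on_slice_snd:
  assumes "continuous_on (A \<times> B) (\<lambda>z. f (fst z) (snd z))" "x \<in> A"
  shows "continuous_on B (f x)"
proof -
  have "continuous_on B ((\<lambda>z. f (fst z) (snd z)) \<circ> Pair x)"
    by (intro continuous_on_compose continuous_intros continuous_on_subset[OF assms(1)])
      (use assms(2) in auto)
  then show ?thesis by (simp add: comp_def)
qed

lemma continuous_on_slice_fst:
  assumes "continuous_on (A \<times> B) (\<lambda>z. f (fst z) (snd z))" "y \<in> B"
  shows "continuous_on A (\<lambda>x. f x y)"
proof -
  have "continuous_on A ((\<lambda>z. f (fst z) (snd z)) \<circ> (\<lambda>x. (x, y)))"
    by (intro continuous_on_compose continuous_intros continuous_on_subset[OF assms(1)])
      (use assms(2) in auto)
  then show ?thesis by (simp add: comp_def)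
qed

lemma continuous_on_slice_mid:
  assumes "continuous_on ((I \<times> J) \<times> UNIV) (\<lambda>z. f (fst (fst z)) (snd (fst z)) (snd z))" "t \<in> J"
  shows "continuous_on (I \<times> A) (\<lambda>z. f (fst z) t (snd z))"
proof -
  have "continuous_on (I \<times> A) ((\<lambda>z. f (fst (fst z)) (snd (fst z)) (snd z)) \<circ> (\<lambda>z. ((fst z, t), snd z)))"
    by (intro continuous_on_compose continuous_intros continuous_on_subset[OF assms(1)])
      (use assms(2) in auto)
  then show ?thesis by (simp add: comp_def)
qed

lemma continuous_on_reassoc:
  assumes "continuous_on (I \<times> J \<times> UNIV) f"
  shows "continuous_on ((I \<times> J) \<times> UNIV) (\<lambda>z. f (fst (fst z), snd (fst z), snd z))"
  by (rule continuous_on_compose2[OF assms]) (auto intro!: continuous_intros)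

lemma continuous_on_integral_param:
  fixes f :: "'a::topological_space \<Rightarrow> real \<Rightarrow> 'b::banach"
  assumes "continuous_on (S \<times> UNIV) (\<lambda>z. f (fst z) (snd z))"
  shows "continuous_on S (\<lambda>x. integral {a..b} (f x))"
proof -
  have "continuous_on (S \<times> cbox a b) (\<lambda>(x, t). f x t)"
    unfolding case_prod_unfold by (rule continuous_on_subset[OF assms]) auto
  from integral_continuous_on_param[OF this] show ?thesis by simp
qed

lemma has_real_derivative_integral_param:
  fixes f f' :: "real \<Rightarrow> real \<Rightarrow> real"
  assumes "\<And>s u. s \<in> U \<Longrightarrow> u \<in> {a..b} \<Longrightarrow> ((\<lambda>s. f s u) has_real_derivative f' s u) (at s within U)"
    and "\<And>s. s \<in> U \<Longrightarrow> continuous_on {a..b} (f s)"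
    and f': "continuous_on (U \<times> {a..b}) (\<lambda>z. f' (fst z) (snd z))"
    and "convex U" "s0 \<in> U"
  shows "((\<lambda>s. integral {a..b} (f s)) has_real_derivative integral {a..b} (f' s0)) (at s0 within U)"
proof -
  have "((\<lambda>s. integral (cbox a b) (f s)) has_vector_derivative integral (cbox a b) (f' s0)) (at s0 within U)"
  proof (rule leibniz_rule_vector_derivative)
    show "continuous_on (U \<times> cbox a b) (\<lambda>(x, t). f' x t)"
      unfolding case_prod_unfold using f' by simp
  qed (use assms in \<open>auto simp: has_real_derivative_iff_has_vector_derivative
        intro!: integrable_continuous_interval\<close>)
  then show ?thesis by (simp add: has_real_derivative_iff_has_vector_derivative)
qed

text \<open>Schwarz' theorem in a form that tolerates boundary points of the time interval: write
  \<open>f x z - f x a\<close> as the integral of \<open>fy x\<close> over \<open>{a..z}\<close>, differentiate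
  under the integral in \<open>x\<close>, and apply the fundamental theorem of calculus in \<open>z\<close>.\<close>
lemma mixed_partials_commute:
  fixes f :: "real \<Rightarrow> real \<Rightarrow> 'a::banach"
  assumes U: "convex U" "x0 \<in> U" "at x0 within U \<noteq> bot"
    and fx: "\<And>y. y \<in> {a..b} \<Longrightarrow> ((\<lambda>x. f x y) has_vector_derivative g y) (at x0 within U)"
    and fy: "\<And>x y. x \<in> U \<Longrightarrow> y \<in> {a..b} \<Longrightarrow> (f x has_vector_derivative fy x y) (at y within {a..b})"
    and fyx: "\<And>x y. x \<in> U \<Longrightarrow> y \<in> {a..b} \<Longrightarrow> ((\<lambda>x. fy x y) has_vector_derivative fyx x y) (at x within U)"
    and cont: "\<And>x. x \<in> U \<Longrightarrow> continuous_on {a..b} (fy x)"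
      "continuous_on (U \<times> {a..b}) (\<lambda>z. fyx (fst z) (snd z))"
    and y: "y \<in> {a..b}"
  shows "(g has_vector_derivative fyx x0 y) (at y within {a..b})"
proof -
  have FTC: "integral {a..z} (fy x) = f x z - f x a" if "x \<in> U" "z \<in> {a..b}" for x z
  proof (rule integral_unique, rule fundamental_theorem_of_calculus)
    show "(f x has_vector_derivative fy x w) (at w within {a..z})" if "w \<in> {a..z}" for w
      using that \<open>z \<in> {a..b}\<close> \<open>x \<in> U\<close>
      by (intro has_vector_derivative_within_subset[OF fy]) auto
  qed (use that in auto)
  have g: "g z = g a + integral {a..z} (fyx x0)" if z: "z \<in> {a..b}" for z
  proof -
    have "((\<lambda>x. integral (cbox a z) (fy x)) has_vector_derivative integral (cbox a z) (fyx x0))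
        (at x0 within U)"
    proof (rule leibniz_rule_vector_derivative)
      show "fy x integrable_on cbox a z" if "x \<in> U" for x
        using z that by (intro integrable_continuous continuous_on_subset[OF cont(1)]) auto
      show "continuous_on (U \<times> cbox a z) (\<lambda>(x, t). fyx x t)"
        using z unfolding case_prod_unfold by (intro continuous_on_subset[OF cont(2)]) auto
    qed (use U z fyx in auto)
    then have "((\<lambda>x. f x z - f x a) has_vector_derivative integral {a..z} (fyx x0)) (at x0 within U)"
      unfolding cbox_interval
      by (rule has_vector_derivative_transform[OF U(2), rotated]) (use z FTC in simp_all)
    moreover have "((\<lambda>x. f x z - f x a) has_vector_derivative g z - g a) (at x0 within U)"
      using z by (intro has_vector_derivative_diff fx) auto
    ultimately have "integral {a..z} (fyx x0) = g z - g a"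
      by (rule vector_derivative_unique_within[OF U(3)])
    then show ?thesis by simp
  qed
  have "continuous_on {a..b} (fyx x0)"
    by (rule continuous_on_slice_snd[OF cont(2) U(2)])
  from integral_has_vector_derivative[OF this y]
  have "((\<lambda>z. g a + integral {a..z} (fyx x0)) has_vector_derivative fyx x0 y) (at y within {a..b})"
    by (auto intro!: derivative_eq_intros)
  then show ?thesis
    by (rule has_vector_derivative_transform[OF y, rotated]) (rule g)
qed

text \<open>Differentiability is local, so the compact interval may be taken around the given point.\<close>
lemma mixed_partials_commute_UNIV:
  fixes f :: "real \<Rightarrow> real \<Rightarrow> 'a::banach"
  assumes U: "convex U" "x0 \<in> U" "at x0 within U \<noteq> bot"
    and fx: "\<And>y. ((\<lambda>x. f x y) has_vector_derivative g y) (at x0 within U)"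
    and fy: "\<And>x y. x \<in> U \<Longrightarrow> (f x has_vector_derivative fy x y) (at y)"
    and fyx: "\<And>x y. x \<in> U \<Longrightarrow> ((\<lambda>x. fy x y) has_vector_derivative fyx x y) (at x within U)"
    and cont: "continuous_on (U \<times> UNIV) (\<lambda>z. fy (fst z) (snd z))"
      "continuous_on (U \<times> UNIV) (\<lambda>z. fyx (fst z) (snd z))"
  shows "(g has_vector_derivative fyx x0 y) (at y)"
proof -
  have "(g has_vector_derivative fyx x0 y) (at y within {y - 1..y + 1})"
  proof (rule mixed_partials_commute[OF U, where f = f and fy = fy])
    show "continuous_on {y - 1..y + 1} (fy x)" if "x \<in> U" for x
      by (rule continuous_on_subset[OF continuous_on_slice_snd[OF cont(1) that]]) simp
    show "continuous_on (U \<times> {y - 1..y + 1}) (\<lambda>z. fyx (fst z) (snd z))"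
      by (rule continuous_on_subset[OF cont(2)]) auto
  qed (auto intro: fx fy fyx has_vector_derivative_at_within)
  then show ?thesis by (simp add: at_within_Icc_at)
qed

lemma vector_derivative_periodic_unique:
  assumes "\<And>u. f (u + p) = f u"
    and "(f has_vector_derivative d) (at (u + p))" "(f has_vector_derivative e) (at u)"
  shows "d = e"
proof -
  have "((\<lambda>v. f (v + p)) has_vector_derivative d) (at u)"
  proof -
    have "((\<lambda>v. v + p) has_vector_derivative 1) (at u)" by (auto intro!: derivative_eq_intros)
    from vector_diff_chain_at[OF this assms(2)] show ?thesis by (simp add: comp_def)
  qed
  then show ?thesis using assms by (simp add: vector_derivative_unique_at)
qed

lemma has_real_derivative_inner:
  assumes "(f has_vector_derivative f') (at x within S)" "(g has_vector_derivative g') (at x within S)"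
  shows "((\<lambda>x. f x \<bullet> g x) has_real_derivative f x \<bullet> g' + f' \<bullet> g x) (at x within S)"
  unfolding has_real_derivative_iff_has_vector_derivative
  by (rule bounded_bilinear.has_vector_derivative[OF bounded_bilinear_inner assms])

lemma has_real_derivative_norm:
  fixes p :: "real \<Rightarrow> 'a::real_inner"
  assumes "(p has_vector_derivative p') (at x within S)" "p x \<noteq> 0"
  shows "((\<lambda>x. norm (p x)) has_real_derivative (p x \<bullet> p') / norm (p x)) (at x within S)"
proof -
  have "((\<lambda>x. sqrt (p x \<bullet> p x)) has_real_derivative (p x \<bullet> p') / norm (p x)) (at x within S)"
    using assms
    unfolding has_vector_derivative_def has_field_derivative_def
    by (auto intro!: derivative_eq_intros simp: inner_commute divide_simps norm_eq_sqrt_inner)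
  then show ?thesis by (simp add: norm_eq_sqrt_inner)
qed

text \<open>The expansion of \<open>q\<close> in the orthogonal frame \<open>p\<close>, \<open>\<i> p\<close>, componentwise.\<close>
lemma inner_ii_frame:
  fixes p q :: complex
  shows "(norm p)\<^sup>2 * Re q = (p \<bullet> q) * Re p + ((\<i> * p) \<bullet> q) * Re (\<i> * p)"
    "(norm p)\<^sup>2 * Im q = (p \<bullet> q) * Im p + ((\<i> * p) \<bullet> q) * Im (\<i> * p)"
  unfolding cmod_power2 by (simp_all add: inner_complex_def algebra_simps power2_eq_square)

lemma unit_frame:
  fixes p q :: complex
  assumes "norm p = 1"
  shows "q = of_real (q \<bullet> p) * p + of_real (q \<bullet> (\<i> * p)) * (\<i> * p)"
proof -
  have "q \<bullet> p = p \<bullet> q" "q \<bullet> (\<i> * p) = (\<i> * p) \<bullet> q" by (rule inner_commute)+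
  then show ?thesis
    using inner_ii_frame[of p q] assms by (intro complex_eqI) simp_all
qed

text \<open>A unit vector field moves orthogonally to itself.  The coefficient is the curvature when the
  variable is the curve parameter and \<open>p\<close> the velocity of the curve.\<close>
lemma has_vector_derivative_unit_tangent:
  fixes p :: "real \<Rightarrow> complex"
  assumes "(p has_vector_derivative p') (at x within S)" "p x \<noteq> 0"
  shows "((\<lambda>x. p x / of_real (norm (p x))) has_vector_derivative
           of_real (((\<i> * p x) \<bullet> p') / norm (p x) ^ 3) * (\<i> * p x)) (at x within S)"
proof -
  let ?n = "norm (p x)"
  have "((\<lambda>x. (1 / norm (p x)) *\<^sub>R p x) has_vector_derivative
      (1 / ?n) *\<^sub>R p' + (- (p x \<bullet> p') / ?n ^ 3) *\<^sub>R p x) (at x within S)"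
    using has_real_derivative_norm[OF assms] assms
    by (auto intro!: derivative_eq_intros simp: divide_simps power3_eq_cube)
  moreover have "(1 / ?n) *\<^sub>R p' + (- (p x \<bullet> p') / ?n ^ 3) *\<^sub>R p x
      = of_real (((\<i> * p x) \<bullet> p') / ?n ^ 3) * (\<i> * p x)" (is "?L = ?R")
  proof -
    have "Re ?L = (?n\<^sup>2 * Re p' - (p x \<bullet> p') * Re (p x)) / ?n ^ 3"
      "Im ?L = (?n\<^sup>2 * Im p' - (p x \<bullet> p') * Im (p x)) / ?n ^ 3"
      using assms(2) by (simp_all add: divide_simps power2_eq_square power3_eq_cube)
    moreover have "Re ?R = ((\<i> * p x) \<bullet> p') * Re (\<i> * p x) / ?n ^ 3"
      "Im ?R = ((\<i> * p x) \<bullet> p') * Im (\<i> * p x) / ?n ^ 3"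
      by simp_all
    ultimately show ?thesis unfolding inner_ii_frame by (simp add: complex_eq_iff)
  qed
  ultimately show ?thesis by (simp add: scaleR_conv_of_real divide_inverse mult.commute)
qed

section \<open>The fundamental lemma of the calculus of variations\<close>

text \<open>If \<open>h\<close> is within \<open>e\<close> of \<open>f\<close> and orthogonal to it with respect to the weight
  \<open>w\<close>, then the weighted integral of \<open>f\<^sup>2\<close> is that of \<open>(f - h) f\<close>, which is at most
  \<open>e\<close> times the weighted integral of \<open>\<bar>f\<bar>\<close>.\<close>
lemma approx_orthogonal_imp_zero:
  fixes f w :: "real \<Rightarrow> real"
  assumes f: "continuous_on {a..b} f" and w: "continuous_on {a..b} w" "\<And>x. x \<in> {a..b} \<Longrightarrow> w x \<ge> 0"
    and H: "\<And>e. e > 0 \<Longrightarrow> \<exists>h. continuous_on {a..b} h \<and> (\<forall>x\<in>{a..b}. \<bar>f x - h x\<bar> < e) \<and>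
              integral {a..b} (\<lambda>x. w x * h x * f x) = 0"
    and "a < b" "x \<in> {a..b}" "w x \<noteq> 0"
  shows "f x = 0"
proof -
  let ?M = "integral {a..b} (\<lambda>x. w x * \<bar>f x\<bar>)"
  have "integral {a..b} (\<lambda>x. w x * (f x)\<^sup>2) \<le> e * ?M" if "e > 0" for e
  proof -
    obtain h where h: "continuous_on {a..b} h" "\<forall>x\<in>{a..b}. \<bar>f x - h x\<bar> < e"
      "integral {a..b} (\<lambda>x. w x * h x * f x) = 0" using H[OF \<open>e > 0\<close>] by blast
    have "integral {a..b} (\<lambda>x. w x * (f x)\<^sup>2)
        = integral {a..b} (\<lambda>x. w x * (f x)\<^sup>2) - integral {a..b} (\<lambda>x. w x * h x * f x)"
      using h by simp
    also have "\<dots> = integral {a..b} (\<lambda>x. w x * (f x)\<^sup>2 - w x * h x * f x)"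
      by (rule integral_diff[symmetric]) (intro integrable_continuous_interval continuous_intros f w h)+
    also have "\<dots> \<le> integral {a..b} (\<lambda>x. e * (w x * \<bar>f x\<bar>))"
    proof (rule integral_le)
      fix x assume x: "x \<in> {a..b}"
      have "w x * (f x)\<^sup>2 - w x * h x * f x = w x * ((f x - h x) * f x)"
        by (simp add: algebra_simps power2_eq_square)
      also have "\<dots> \<le> w x * (e * \<bar>f x\<bar>)"
      proof (intro mult_left_mono w x)
        have "(f x - h x) * f x \<le> \<bar>f x - h x\<bar> * \<bar>f x\<bar>" by (metis abs_ge_self abs_mult)
        also have "\<dots> \<le> e * \<bar>f x\<bar>" using h x by (intro mult_right_mono) (auto intro: less_imp_le)
        finally show "(f x - h x) * f x \<le> e * \<bar>f x\<bar>" .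
      qed
      finally show "w x * (f x)\<^sup>2 - w x * h x * f x \<le> e * (w x * \<bar>f x\<bar>)" by (simp add: algebra_simps)
    qed (intro integrable_continuous_interval continuous_intros f w h)+
    finally show ?thesis by simp
  qed
  note le = this
  have "integral {a..b} (\<lambda>x. w x * (f x)\<^sup>2) \<le> 0"
  proof (rule field_le_epsilon)
    fix e :: real assume "e > 0"
    have M: "?M \<ge> 0"
      by (intro integral_nonneg integrable_continuous_interval continuous_intros f w) (use w in auto)
    have "integral {a..b} (\<lambda>x. w x * (f x)\<^sup>2) \<le> e / (?M + 1) * ?M"
      using le[of "e / (?M + 1)"] \<open>e > 0\<close> M by auto
    also have "\<dots> \<le> e" using M \<open>e > 0\<close> by (auto simp: field_simps)
    finally show "integral {a..b} (\<lambda>x. w x * (f x)\<^sup>2) \<le> 0 + e" by simp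
  qed
  moreover have "integral {a..b} (\<lambda>x. w x * (f x)\<^sup>2) \<ge> 0"
    by (intro integral_nonneg integrable_continuous_interval continuous_intros f w) (use w in auto)
  ultimately have "integral {a..b} (\<lambda>x. w x * (f x)\<^sup>2) = 0" by simp
  then have "w x * (f x)\<^sup>2 = 0"
    using \<open>a < b\<close> \<open>x \<in> {a..b}\<close> w
    by (subst (asm) integral_eq_0_iff) (auto intro!: continuous_intros f)
  then show ?thesis using \<open>w x \<noteq> 0\<close> by simp
qed

lemma periodic_int: "(\<And>x. f (x + p) = f x) \<Longrightarrow> f (x + of_int k * p) = f x"
  for f :: "real \<Rightarrow> 'a" and p :: real
proof (induction k rule: int_induct[where k = 0])
  case (step1 i)
  then show ?case using step1(3)[of "x + of_int i * p"] by (simp add: algebra_simps)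
next
  case (step2 i)
  then show ?case using step2(3)[of "x + of_int (i - 1) * p"] by (simp add: algebra_simps)
qed simp

text \<open>This makes Stone-Weierstrass on the unit circle applicable to periodic functions.  The only
  issue is continuity of the factor across the branch cut of \<open>Arg\<close>, where \<open>Arg2pi\<close> is
  continuous; by periodicity both give the same factor.\<close>
lemma periodic_factors_through_cis:
  fixes f :: "real \<Rightarrow> 'a::topological_space"
  assumes f: "continuous_on UNIV f" and per: "\<And>x. f (x + 2 * pi) = f x"
  obtains g where "continuous_on (sphere 0 1) g" "\<And>x. g (cis x) = f x"
proof -
  have eq: "f x = f y" if "cis x = cis y" for x y
  proof -
    have "sin x = sin y \<and> cos x = cos y" using that by (simp add: complex_eq_iff)
    then obtain k :: int where "x = y + of_int k * (2 * pi)"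
      unfolding sin_cos_eq_iff by (auto simp: algebra_simps)
    then show ?thesis using periodic_int[of f "2 * pi", OF per] by simp
  qed
  have Arg: "f (Arg z) = f (Arg2pi z)" if "z \<noteq> 0" for z
  proof (rule eq)
    have "cis (Arg2pi z) = sgn z"
      using that Arg2pi_eq[of z] by (simp add: sgn_div_norm cis_conv_exp scaleR_conv_of_real field_simps)
    then show "cis (Arg z) = cis (Arg2pi z)" using that by (simp add: cis_Arg)
  qed
  show thesis
  proof (rule that[of "\<lambda>z. f (Arg z)"])
    show "f (Arg (cis x)) = f x" for x by (intro eq) (simp add: cis_Arg)
    show "continuous_on (sphere 0 1) (\<lambda>z. f (Arg z))"
    proof (intro continuous_at_imp_continuous_on ballI)
      fix z :: complex assume z: "z \<in> sphere 0 1"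
      show "isCont (\<lambda>z. f (Arg z)) z"
      proof (cases "z \<in> \<real>\<^sub>\<le>\<^sub>0")
        case False
        then show ?thesis using f
          by (intro isCont_o2[OF continuous_at_Arg]) (auto simp: continuous_on_eq_continuous_at)
      next
        case True
        with z have "z \<notin> \<real>\<^sub>\<ge>\<^sub>0" by (auto simp: complex_nonpos_Reals_iff complex_nonneg_Reals_iff cmod_def)
        then have "isCont (\<lambda>z. f (Arg2pi z)) z" using f
          by (intro isCont_o2[OF continuous_at_Arg2pi]) (auto simp: continuous_on_eq_continuous_at)
        moreover have "\<forall>\<^sub>F x in nhds z. f (Arg2pi x) = f (Arg x)"
          by (rule eventually_mono[OF eventually_nhds_in_open[of "-{0}" z]]) (use z in \<open>auto simp: Arg\<close>)
        ultimately show ?thesis by (simp add: isCont_cong)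
      qed
    qed
  qed
qed

text \<open>Polynomial functions are built from linear ones by sums and products, so it suffices to
  check the linear ones.\<close>
lemma Ck_on_real_polynomial_compose:
  assumes "\<And>h :: _ \<Rightarrow> real. bounded_linear h \<Longrightarrow> Ck_on k S (\<lambda>x. h (g x))"
  shows "real_polynomial_function p \<Longrightarrow> Ck_on k S (\<lambda>x. p (g x) :: real)"
proof (induction rule: real_polynomial_function.induct)
  case (linear f)
  then show ?case by (rule assms)
qed (auto intro: Ck_on_const Ck_on_add Ck_on_bilinear[OF bounded_bilinear_mult])

lemma Ck_on_polynomial: "real_polynomial_function p \<Longrightarrow> Ck_on k S p"
  by (rule Ck_on_real_polynomial_compose[where g = "\<lambda>x. x"]) (auto intro: Ck_on_bounded_linear)

lemma Ck_on_trig_polynomial: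
  assumes "real_polynomial_function p"
  shows "Ck_on k S (\<lambda>x. p (cis x))"
proof (rule Ck_on_real_polynomial_compose[OF _ assms])
  fix h :: "complex \<Rightarrow> real" assume h: "bounded_linear h"
  have "cis x = cos x *\<^sub>R 1 + sin x *\<^sub>R \<i>" for x by (simp add: complex_eq_iff)
  then have "h (cis x) = cos x * h 1 + sin x * h \<i>" for x
    using h by (simp add: linear_simps del: scaleR_conv_of_real)
  moreover have "Ck_on k S (\<lambda>x. cos x * h 1 + sin x * h \<i>)"
    using Ck_on_cos_sin Ck_on_compose_linear[OF bounded_linear_ident]
    by (intro Ck_on_add Ck_on_bilinear[OF bounded_bilinear_mult] Ck_on_const) auto
  ultimately show "Ck_on k S (\<lambda>x. h (cis x))" by simp
qed

text \<open>The two variables are separated: for a fixed trigonometric polynomial the inner integral is a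
  continuous function of time, hence zero at interior times by polynomial approximation; at each
  such time the function is then orthogonal to all trigonometric polynomials.  The endpoints, where
  the weight vanishes, are reached by continuity.\<close>
lemma fundamental_lemma:
  fixes F :: "real \<Rightarrow> real \<Rightarrow> real"
  assumes "t0 < t1" and F: "continuous_on ({t0..t1} \<times> UNIV) (\<lambda>z. F (fst z) (snd z))"
    and per: "\<And>t u. t \<in> {t0..t1} \<Longrightarrow> F t (u + 2 * pi) = F t u"
    and orth: "\<And>p q. real_polynomial_function p \<Longrightarrow> real_polynomial_function q \<Longrightarrow>
        integral {t0..t1} (\<lambda>t. (t - t0) * (t1 - t) * p t *
          integral {0..2 * pi} (\<lambda>u. q (cis u) * F t u)) = 0"
    and t: "t \<in> {t0..t1}"
  shows "F t u = 0"
proof -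
  have Ft: "continuous_on UNIV (F t)" if "t \<in> {t0..t1}" for t
    by (rule continuous_on_slice_snd[OF F that])
  have Fu: "continuous_on {t0..t1} (\<lambda>t. F t u)" for u
    by (rule continuous_on_slice_fst[OF F]) simp
  have qc: "continuous_on A (\<lambda>u. q (cis u))" if "real_polynomial_function q" for q A
    using Ck_on_imp_continuous[OF Ck_on_trig_polynomial[OF that]] .
  have 1: "integral {0..2 * pi} (\<lambda>u. q (cis u) * F t u) = 0"
    if q: "real_polynomial_function q" and t: "t \<in> {t0<..<t1}" for q t
  proof (rule approx_orthogonal_imp_zero[where f = "\<lambda>t. integral {0..2 * pi} (\<lambda>u. q (cis u) * F t u)"
      and w = "\<lambda>t. (t - t0) * (t1 - t)" and a = t0 and b = t1 and x = t])
    let ?G = "\<lambda>t. integral {0..2 * pi} (\<lambda>u. q (cis u) * F t u)"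
    show cG: "continuous_on {t0..t1} ?G"
      by (intro continuous_on_integral_param continuous_intros F
          continuous_on_compose2[OF qc[OF q, of UNIV]]) auto
    fix e :: real assume "e > 0"
    then obtain p where p: "real_polynomial_function p" "\<And>t. t \<in> {t0..t1} \<Longrightarrow> \<bar>?G t - p t\<bar> < e"
      using Stone_Weierstrass_real_polynomial_function[OF compact_Icc cG] by metis
    show "\<exists>h. continuous_on {t0..t1} h \<and> (\<forall>x\<in>{t0..t1}. \<bar>?G x - h x\<bar> < e) \<and>
        integral {t0..t1} (\<lambda>x. (x - t0) * (t1 - x) * h x * ?G x) = 0"
      using p orth[OF p(1) q] Ck_on_imp_continuous[OF Ck_on_polynomial[OF p(1)]]
      by (intro exI[of _ p]) auto
  qed (use t in \<open>auto intro!: continuous_intros\<close>)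
  have 2: "F t u = 0" if t: "t \<in> {t0<..<t1}" and u: "u \<in> {0..2 * pi}" for t u
  proof (rule approx_orthogonal_imp_zero[where f = "F t" and w = "\<lambda>_. 1" and a = 0 and b = "2 * pi" and x = u])
    show "continuous_on {0..2 * pi} (F t)" using Ft[of t] t continuous_on_subset by auto
    fix e :: real assume "e > 0"
    obtain g where g: "continuous_on (sphere 0 1) g" "\<And>x. g (cis x) = F t x"
      using periodic_factors_through_cis[of "F t"] Ft[of t] per[of t] t by auto
    obtain q where q: "real_polynomial_function q" "\<And>z. z \<in> sphere 0 1 \<Longrightarrow> \<bar>g z - q z\<bar> < e"
      using Stone_Weierstrass_real_polynomial_function[OF compact_sphere g(1) \<open>e > 0\<close>] by metis
    show "\<exists>h. continuous_on {0..2 * pi} h \<and> (\<forall>x\<in>{0..2 * pi}. \<bar>F t x - h x\<bar> < e) \<and>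
        integral {0..2 * pi} (\<lambda>x. 1 * h x * F t x) = 0"
    proof (intro exI[of _ "\<lambda>u. q (cis u)"] conjI ballI)
      show "\<bar>F t x - q (cis x)\<bar> < e" for x using q(2)[of "cis x"] g(2)[of x] by simp
    qed (use 1[OF q(1) t] qc[OF q(1)] in auto)
  qed (use u in auto)
  have 3: "F t u = 0" if u: "u \<in> {0..2 * pi}" for u
    by (rule continuous_constant_on_closure[of "{t0<..<t1}" "\<lambda>t. F t u"])
      (use Fu[of u] 2[OF _ u] t \<open>t0 < t1\<close> in auto)
  define k where "k = \<lfloor>u / (2 * pi)\<rfloor>"
  have "of_int k \<le> u / (2 * pi)" "u / (2 * pi) \<le> of_int k + 1" unfolding k_def by linarith+
  then have "u + of_int (- k) * (2 * pi) \<in> {0..2 * pi}" by (auto simp: field_simps)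
  from 3[OF this] show ?thesis using periodic_int[of "F t" "2 * pi" u "- k"] per[OF t] by auto
qed

section \<open>Geometry of a normal flow of plane curves\<close>

text \<open>The partial derivatives are parameters, so that the geometry can be computed with explicit
  functions instead of derivative operators that are one-sided at \<open>t0\<close> and \<open>t1\<close>.  Here
  \<open>u\<close> is the curve parameter, written \<open>\<theta>\<close> elsewhere.\<close>
locale normal_flow =
  fixes t0 t1 :: real and c ct cu ctt ctu cuu :: "real \<Rightarrow> real \<Rightarrow> complex"
    and a :: "real \<Rightarrow> real \<Rightarrow> real" and \<phi> \<phi>' :: "real \<Rightarrow> real"
  assumes t0_less: "t0 < t1"
    and c_t: "\<And>t u. t \<in> {t0..t1} \<Longrightarrow> ((\<lambda>t. c t u) has_vector_derivative ct t u) (at t within {t0..t1})"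
    and c_u: "\<And>t u. t \<in> {t0..t1} \<Longrightarrow> (c t has_vector_derivative cu t u) (at u)"
    and ct_t: "\<And>t u. t \<in> {t0..t1} \<Longrightarrow> ((\<lambda>t. ct t u) has_vector_derivative ctt t u) (at t within {t0..t1})"
    and ct_u: "\<And>t u. t \<in> {t0..t1} \<Longrightarrow> (ct t has_vector_derivative ctu t u) (at u)"
    and cu_t: "\<And>t u. t \<in> {t0..t1} \<Longrightarrow> ((\<lambda>t. cu t u) has_vector_derivative ctu t u) (at t within {t0..t1})"
    and cu_u: "\<And>t u. t \<in> {t0..t1} \<Longrightarrow> (cu t has_vector_derivative cuu t u) (at u)"
    and cont_partials [continuous_intros]:
      "continuous_on ({t0..t1} \<times> UNIV) (\<lambda>z. ct (fst z) (snd z))"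
      "continuous_on ({t0..t1} \<times> UNIV) (\<lambda>z. cu (fst z) (snd z))"
      "continuous_on ({t0..t1} \<times> UNIV) (\<lambda>z. ctt (fst z) (snd z))"
      "continuous_on ({t0..t1} \<times> UNIV) (\<lambda>z. ctu (fst z) (snd z))"
      "continuous_on ({t0..t1} \<times> UNIV) (\<lambda>z. cuu (fst z) (snd z))"
    and cu_nz: "\<And>t u. t \<in> {t0..t1} \<Longrightarrow> cu t u \<noteq> 0"
    and periodic: "\<And>t u. t \<in> {t0..t1} \<Longrightarrow> c t (u + 2 * pi) = c t u"
    and normal: "\<And>t u. t \<in> {t0..t1} \<Longrightarrow> ct t u = \<i> * of_real (a t u) * (cu t u / of_real (norm (cu t u)))"
    and \<phi>_pos: "\<And>l. l > 0 \<Longrightarrow> \<phi> l > 0"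
    and \<phi>_deriv: "\<And>l. l > 0 \<Longrightarrow> (\<phi> has_real_derivative \<phi>' l) (at l)"
    and \<phi>'_cont: "continuous_on {0<..} \<phi>'"
begin

definition tang :: "real \<Rightarrow> real \<Rightarrow> complex" where
  "tang t u = cu t u / of_real (norm (cu t u))"

definition curv :: "real \<Rightarrow> real \<Rightarrow> real" where
  "curv t u = ((\<i> * cu t u) \<bullet> cuu t u) / norm (cu t u) ^ 3"

definition len :: "real \<Rightarrow> real" where
  "len t = integral {0..2 * pi} (\<lambda>u. norm (cu t u))"

definition int_a2 :: "real \<Rightarrow> real" where
  "int_a2 t = integral {0..2 * pi} (\<lambda>u. (a t u)\<^sup>2 * norm (cu t u))"

definition int_ak :: "real \<Rightarrow> real" where
  "int_ak t = integral {0..2 * pi} (\<lambda>u. a t u * curv t u * norm (cu t u))"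

text \<open>Differentiating \<open>a = c\<^sub>t \<bullet> \<i> T\<close> in time or in the curve parameter, the term containing
  the derivative of \<open>T\<close> vanishes, since that derivative is normal and so turned by \<open>\<i>\<close> into a
  tangent vector, orthogonal to \<open>c\<^sub>t\<close>.  This gives the two formulas below as the partial
  derivatives of \<open>a\<close>.\<close>
definition a_dot :: "real \<Rightarrow> real \<Rightarrow> real" where
  "a_dot t u = ctt t u \<bullet> (\<i> * tang t u)"

definition a_prime :: "real \<Rightarrow> real \<Rightarrow> real" where
  "a_prime t u = ctu t u \<bullet> (\<i> * tang t u)"

definition geodesic_rhs :: "real \<Rightarrow> real \<Rightarrow> real" where
  "geodesic_rhs t u = curv t u / 2 * ((a t u)\<^sup>2 - \<phi>' (len t) / \<phi> (len t) * int_a2 t)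
     + \<phi>' (len t) / \<phi> (len t) * a t u * int_ak t"

lemma norm_tang: "t \<in> {t0..t1} \<Longrightarrow> norm (tang t u) = 1"
  using cu_nz by (simp add: tang_def norm_divide)

lemma cu_eq: "t \<in> {t0..t1} \<Longrightarrow> cu t u = of_real (norm (cu t u)) * tang t u"
  using cu_nz by (simp add: tang_def)

lemma ct_eq: "t \<in> {t0..t1} \<Longrightarrow> ct t u = of_real (a t u) * (\<i> * tang t u)"
  using normal by (simp add: tang_def)

lemma a_eq: "t \<in> {t0..t1} \<Longrightarrow> a t u = ct t u \<bullet> (\<i> * tang t u)"
  using norm_tang[of t u]
  by (simp add: ct_eq dot_square_norm norm_mult flip: scaleR_conv_of_real)

lemma ct_ct: "t \<in> {t0..t1} \<Longrightarrow> ct t u \<bullet> ct t u = (a t u)\<^sup>2"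
proof -
  assume t: "t \<in> {t0..t1}"
  have "norm (ct t u) = \<bar>a t u\<bar>" by (simp add: ct_eq[OF t] norm_mult norm_tang[OF t])
  then show ?thesis by (simp add: dot_square_norm)
qed

lemma ct_tang: "t \<in> {t0..t1} \<Longrightarrow> ct t u \<bullet> tang t u = 0"
  by (simp add: ct_eq inner_complex_def algebra_simps)

lemma ct_cu: "t \<in> {t0..t1} \<Longrightarrow> ct t u \<bullet> cu t u = 0"
  by (subst cu_eq) (auto simp: ct_eq inner_complex_def algebra_simps)

lemma tang_u:
  assumes t: "t \<in> {t0..t1}"
  shows "(tang t has_vector_derivative of_real (curv t u) * (\<i> * cu t u)) (at u)"
  using has_vector_derivative_unit_tangent[OF cu_u[OF t] cu_nz[OF t]]
  by (simp add: tang_def[abs_def] curv_def)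

lemma tang_t:
  assumes t: "t \<in> {t0..t1}"
  shows "((\<lambda>t. tang t u) has_vector_derivative
     of_real (((\<i> * cu t u) \<bullet> ctu t u) / norm (cu t u) ^ 3) * (\<i> * cu t u)) (at t within {t0..t1})"
  using has_vector_derivative_unit_tangent[OF cu_t[OF t] cu_nz[OF t]]
  by (simp add: tang_def[abs_def])

lemma a_u:
  assumes t: "t \<in> {t0..t1}"
  shows "(a t has_real_derivative a_prime t u) (at u)"
proof -
  have "((\<lambda>u. ct t u \<bullet> (\<i> * tang t u)) has_real_derivative
      ct t u \<bullet> (\<i> * (of_real (curv t u) * (\<i> * cu t u))) + ctu t u \<bullet> (\<i> * tang t u)) (at u)"
    by (rule has_real_derivative_inner[OF ct_u[OF t] has_vector_derivative_mult_right[OF tang_u[OF t]]])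
  moreover have "ct t u \<bullet> (\<i> * (of_real (curv t u) * (\<i> * cu t u))) = - curv t u * (ct t u \<bullet> cu t u)"
    by (simp add: inner_complex_def algebra_simps)
  moreover have "(\<lambda>u. ct t u \<bullet> (\<i> * tang t u)) = a t"
    using a_eq[OF t] by auto
  ultimately show ?thesis by (simp add: a_prime_def ct_cu[OF t])
qed

lemma a_t:
  assumes t: "t \<in> {t0..t1}"
  shows "((\<lambda>t. a t u) has_real_derivative a_dot t u) (at t within {t0..t1})"
proof -
  define r where "r = ((\<i> * cu t u) \<bullet> ctu t u) / norm (cu t u) ^ 3"
  have "((\<lambda>t. ct t u \<bullet> (\<i> * tang t u)) has_real_derivative
      ct t u \<bullet> (\<i> * (of_real r * (\<i> * cu t u))) + ctt t u \<bullet> (\<i> * tang t u)) (at t within {t0..t1})"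
    unfolding r_def
    by (rule has_real_derivative_inner[OF ct_t[OF t] has_vector_derivative_mult_right[OF tang_t[OF t]]])
  moreover have "ct t u \<bullet> (\<i> * (of_real r * (\<i> * cu t u))) = - r * (ct t u \<bullet> cu t u)"
    by (simp add: inner_complex_def algebra_simps)
  ultimately have "((\<lambda>t. ct t u \<bullet> (\<i> * tang t u)) has_real_derivative a_dot t u) (at t within {t0..t1})"
    by (simp add: a_dot_def ct_cu[OF t])
  then show ?thesis
    unfolding has_real_derivative_iff_has_vector_derivative
    by (rule has_vector_derivative_transform[OF t, rotated]) (simp add: a_eq)
qed

text \<open>Obtained by differentiating \<open>c\<^sub>t \<bullet> T = 0\<close> along the curve.  Its integral is the
  derivative of the length.\<close>
lemma ctu_tang:
  assumes t: "t \<in> {t0..t1}"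
  shows "ctu t u \<bullet> tang t u = - a t u * curv t u * norm (cu t u)"
proof -
  have "((\<lambda>u. ct t u \<bullet> tang t u) has_real_derivative
      ct t u \<bullet> (of_real (curv t u) * (\<i> * cu t u)) + ctu t u \<bullet> tang t u) (at u)"
    by (rule has_real_derivative_inner[OF ct_u[OF t] tang_u[OF t]])
  then have "((\<lambda>u. 0) has_real_derivative
      ct t u \<bullet> (of_real (curv t u) * (\<i> * cu t u)) + ctu t u \<bullet> tang t u) (at u)"
    by (simp only: ct_tang[OF t])
  then have "ct t u \<bullet> (of_real (curv t u) * (\<i> * cu t u)) + ctu t u \<bullet> tang t u = 0"
    by (rule DERIV_unique[OF _ DERIV_const])
  moreover have "ct t u \<bullet> (of_real (curv t u) * (\<i> * cu t u))
      = curv t u * norm (cu t u) * (ct t u \<bullet> (\<i> * tang t u))"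
    by (subst cu_eq[OF t]) (simp add: inner_complex_def algebra_simps)
  ultimately have "ctu t u \<bullet> tang t u = - (curv t u * norm (cu t u) * (ct t u \<bullet> (\<i> * tang t u)))"
    by linarith
  then show ?thesis by (simp add: a_eq[OF t, of u])
qed

lemma ii_ctu:
  assumes t: "t \<in> {t0..t1}"
  shows "\<i> * ctu t u = - of_real (a t u * curv t u) * (\<i> * cu t u) - of_real (a_prime t u) * tang t u"
proof -
  have "ctu t u = of_real (ctu t u \<bullet> tang t u) * tang t u + of_real (ctu t u \<bullet> (\<i> * tang t u)) * (\<i> * tang t u)"
    by (rule unit_frame[OF norm_tang[OF t]])
  then have "\<i> * ctu t u = \<i> * (of_real (- a t u * curv t u * norm (cu t u)) * tang t u
      + of_real (a_prime t u) * (\<i> * tang t u))"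
    unfolding ctu_tang[OF t] a_prime_def[symmetric] by simp
  also have "\<dots> = - of_real (a t u * curv t u) * (\<i> * (of_real (norm (cu t u)) * tang t u)) - of_real (a_prime t u) * tang t u"
    by (simp add: algebra_simps)
  finally show ?thesis unfolding cu_eq[OF t, symmetric] .
qed

lemma cont_tang [continuous_intros]: "continuous_on ({t0..t1} \<times> UNIV) (\<lambda>z. tang (fst z) (snd z))"
  unfolding tang_def using cu_nz by (auto intro!: continuous_intros)

lemma cont_curv [continuous_intros]: "continuous_on ({t0..t1} \<times> UNIV) (\<lambda>z. curv (fst z) (snd z))"
  unfolding curv_def using cu_nz by (auto intro!: continuous_intros)

lemma cont_a [continuous_intros]: "continuous_on ({t0..t1} \<times> UNIV) (\<lambda>z. a (fst z) (snd z))"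
proof -
  have "continuous_on ({t0..t1} \<times> UNIV) (\<lambda>z. ct (fst z) (snd z) \<bullet> (\<i> * tang (fst z) (snd z)))"
    by (intro continuous_intros)
  then show ?thesis by (rule continuous_on_eq) (auto simp: a_eq)
qed

lemma cont_a_dot [continuous_intros]: "continuous_on ({t0..t1} \<times> UNIV) (\<lambda>z. a_dot (fst z) (snd z))"
  unfolding a_dot_def by (intro continuous_intros)

lemma len_pos: "t \<in> {t0..t1} \<Longrightarrow> len t > 0"
proof -
  assume t: "t \<in> {t0..t1}"
  have c: "continuous_on {0..2 * pi} (\<lambda>u. norm (cu t u))"
    by (intro continuous_intros continuous_on_subset[OF continuous_on_slice_snd[OF cont_partials(2) t]]) auto
  have "len t \<ge> 0" unfolding len_def by (intro integral_nonneg integrable_continuous_interval c) auto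
  moreover have "len t \<noteq> 0"
    unfolding len_def using integral_eq_0_iff[OF c] cu_nz[OF t, of 0] by auto
  ultimately show ?thesis by simp
qed

lemma cont_len [continuous_intros]: "continuous_on {t0..t1} len"
  unfolding len_def by (intro continuous_on_integral_param continuous_intros)

lemma cont_int_a2 [continuous_intros]: "continuous_on {t0..t1} int_a2"
  unfolding int_a2_def by (intro continuous_on_integral_param continuous_intros)

lemma cont_int_ak [continuous_intros]: "continuous_on {t0..t1} int_ak"
  unfolding int_ak_def by (intro continuous_on_integral_param continuous_intros)

lemma cont_\<phi>_len: "continuous_on {t0..t1} (\<lambda>t. \<phi> (len t))"
proof (rule continuous_on_compose2[of "{0<..}" \<phi>])
  show "continuous_on {0<..} \<phi>"
    by (intro continuous_at_imp_continuous_on ballI DERIV_isCont[OF \<phi>_deriv]) auto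
qed (auto intro: continuous_intros len_pos)

lemma cont_\<phi>'_len: "continuous_on {t0..t1} (\<lambda>t. \<phi>' (len t))"
  by (rule continuous_on_compose2[OF \<phi>'_cont cont_len]) (auto intro: len_pos)

lemma continuous_on_fst_compose: "continuous_on {t0..t1} f \<Longrightarrow> continuous_on ({t0..t1} \<times> UNIV) (\<lambda>z. f (fst z))"
  by (rule continuous_on_compose2[of _ f]) (auto intro: continuous_intros)

lemma \<phi>_len_nz: "t \<in> {t0..t1} \<Longrightarrow> \<phi> (len t) \<noteq> 0"
  using \<phi>_pos[OF len_pos, of t] by simp

lemma cont_geodesic_rhs [continuous_intros]: "continuous_on ({t0..t1} \<times> UNIV) (\<lambda>z. geodesic_rhs (fst z) (snd z))"
  unfolding geodesic_rhs_def
  by (intro continuous_intros continuous_on_fst_compose[OF cont_\<phi>_len] continuous_on_fst_compose[OF cont_\<phi>'_len]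
      continuous_on_fst_compose[OF cont_int_a2] continuous_on_fst_compose[OF cont_int_ak])
    (auto simp: \<phi>_len_nz)

text \<open>Only the curves themselves are assumed to be closed; their derivatives inherit the period
  because derivatives are unique.\<close>
lemma ct_periodic: "t \<in> {t0..t1} \<Longrightarrow> ct t (u + 2 * pi) = ct t u"
proof -
  assume t: "t \<in> {t0..t1}"
  have "((\<lambda>t. c t u) has_vector_derivative ct t (u + 2 * pi)) (at t within {t0..t1})"
    by (rule has_vector_derivative_transform[OF t _ c_t[OF t]]) (simp add: periodic)
  from vector_derivative_within_closed_interval[OF t0_less t this]
    vector_derivative_within_closed_interval[OF t0_less t c_t[OF t, of u]]
  show ?thesis by simp
qed

lemma ctt_periodic: "t \<in> {t0..t1} \<Longrightarrow> ctt t (u + 2 * pi) = ctt t u"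
proof -
  assume t: "t \<in> {t0..t1}"
  have "((\<lambda>t. ct t u) has_vector_derivative ctt t (u + 2 * pi)) (at t within {t0..t1})"
    by (rule has_vector_derivative_transform[OF t _ ct_t[OF t]]) (simp add: ct_periodic)
  from vector_derivative_within_closed_interval[OF t0_less t this]
    vector_derivative_within_closed_interval[OF t0_less t ct_t[OF t, of u]]
  show ?thesis by simp
qed

lemma cu_periodic: "t \<in> {t0..t1} \<Longrightarrow> cu t (u + 2 * pi) = cu t u"
  by (rule vector_derivative_periodic_unique[OF periodic c_u c_u])

lemma cuu_periodic: "t \<in> {t0..t1} \<Longrightarrow> cuu t (u + 2 * pi) = cuu t u"
  by (rule vector_derivative_periodic_unique[OF cu_periodic cu_u cu_u])

lemma tang_periodic: "t \<in> {t0..t1} \<Longrightarrow> tang t (u + 2 * pi) = tang t u"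
  by (simp add: tang_def cu_periodic)

lemma a_periodic: "t \<in> {t0..t1} \<Longrightarrow> a t (u + 2 * pi) = a t u"
  by (simp add: a_eq tang_periodic ct_periodic)

lemma residual_periodic: "t \<in> {t0..t1} \<Longrightarrow> geodesic_rhs t (u + 2 * pi) - a_dot t (u + 2 * pi) = geodesic_rhs t u - a_dot t u"
  by (simp add: geodesic_rhs_def a_dot_def curv_def a_periodic tang_periodic cu_periodic cuu_periodic ctt_periodic)

lemma len_t:
  assumes t: "t \<in> {t0..t1}"
  shows "(len has_real_derivative - int_ak t) (at t within {t0..t1})"
proof -
  have "((\<lambda>t. integral {0..2 * pi} (\<lambda>u. norm (cu t u))) has_real_derivative
      integral {0..2 * pi} (\<lambda>u. ctu t u \<bullet> tang t u)) (at t within {t0..t1})"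
  proof (rule has_real_derivative_integral_param)
    fix s u :: real assume s: "s \<in> {t0..t1}"
    show "((\<lambda>s. norm (cu s u)) has_real_derivative ctu s u \<bullet> tang s u) (at s within {t0..t1})"
      using has_real_derivative_norm[OF cu_t[OF s, of u] cu_nz[OF s]]
      by (simp add: tang_def inner_complex_def add_divide_distrib algebra_simps Re_divide_of_real Im_divide_of_real)
  next
    show "continuous_on {0..2 * pi} (\<lambda>u. norm (cu s u))" if "s \<in> {t0..t1}" for s
      by (intro continuous_intros continuous_on_subset[OF continuous_on_slice_snd[OF cont_partials(2) that]]) auto
    show "continuous_on ({t0..t1} \<times> {0..2 * pi}) (\<lambda>z. ctu (fst z) (snd z) \<bullet> tang (fst z) (snd z))"
      by (rule continuous_on_subset[of "{t0..t1} \<times> UNIV"]) (auto intro!: continuous_intros)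
  qed (use t in auto)
  then show ?thesis
    by (simp add: ctu_tang[OF t] len_def[abs_def] int_ak_def)
qed

section \<open>The first variation after integration by parts\<close>

text \<open>The left-hand side is the derivative of the energy as it comes from differentiation under the
  integrals.  At each time the two integrands differ by the derivative of \<open>Q\<close> and the integral
  of a total derivative over the closed curve; the latter is zero, and the former integrates to zero
  over time because \<open>W\<close> vanishes at the endpoints.\<close>
lemma first_variation:
  assumes W_t: "\<And>t u. t \<in> {t0..t1} \<Longrightarrow> ((\<lambda>t. W t u) has_vector_derivative Wt t u) (at t within {t0..t1})"
    and W_u: "\<And>t u. t \<in> {t0..t1} \<Longrightarrow> (W t has_vector_derivative Wu t u) (at u)"
    and cont_W [continuous_intros]:
      "continuous_on ({t0..t1} \<times> UNIV) (\<lambda>z. W (fst z) (snd z))"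
      "continuous_on ({t0..t1} \<times> UNIV) (\<lambda>z. Wt (fst z) (snd z))"
      "continuous_on ({t0..t1} \<times> UNIV) (\<lambda>z. Wu (fst z) (snd z))"
    and W_per: "\<And>t u. t \<in> {t0..t1} \<Longrightarrow> W t (u + 2 * pi) = W t u"
    and W_end: "\<And>u. W t0 u = 0" "\<And>u. W t1 u = 0"
  shows "integral {t0..t1} (\<lambda>t. 1 / 2 *
      (\<phi>' (len t) * integral {0..2 * pi} (\<lambda>u. Wu t u \<bullet> tang t u) *
         integral {0..2 * pi} (\<lambda>u. (ct t u \<bullet> ct t u) * norm (cu t u)) +
       \<phi> (len t) * integral {0..2 * pi} (\<lambda>u. 2 * (ct t u \<bullet> Wt t u) * norm (cu t u) +
           (ct t u \<bullet> ct t u) * (Wu t u \<bullet> tang t u))))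
    = integral {t0..t1} (\<lambda>t. \<phi> (len t) *
        integral {0..2 * pi} (\<lambda>u. (W t u \<bullet> (\<i> * cu t u)) * (geodesic_rhs t u - a_dot t u)))"
    (is "integral _ ?I = integral _ ?X")
proof -
  let ?S = "{t0..t1} \<times> (UNIV :: real set)"
  define q where "q t u = a t u * (W t u \<bullet> (\<i> * cu t u))" for t u
  define q' where "q' t u = a_dot t u * (W t u \<bullet> (\<i> * cu t u)) + a t u * (Wt t u \<bullet> (\<i> * cu t u))
     + a t u * (W t u \<bullet> (\<i> * ctu t u))" for t u
  \<comment> \<open>The function whose derivative contains all the terms with \<open>Wt\<close>.\<close>
  define Q where "Q t = \<phi> (len t) * integral {0..2 * pi} (q t)" for t
  define Q' where "Q' t = - \<phi>' (len t) * int_ak t * integral {0..2 * pi} (q t)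
     + \<phi> (len t) * integral {0..2 * pi} (q' t)" for t
  define f1 where "f1 t u = Wu t u \<bullet> tang t u" for t u
  define f2 where "f2 t u = 2 * (ct t u \<bullet> Wt t u) * norm (cu t u) + (ct t u \<bullet> ct t u) * (Wu t u \<bullet> tang t u)" for t u
  define f5 where "f5 t u = (W t u \<bullet> (\<i> * cu t u)) * (geodesic_rhs t u - a_dot t u)" for t u
  have conts: "continuous_on ?S (\<lambda>z. q (fst z) (snd z))" "continuous_on ?S (\<lambda>z. q' (fst z) (snd z))"
      "continuous_on ?S (\<lambda>z. f1 (fst z) (snd z))" "continuous_on ?S (\<lambda>z. f2 (fst z) (snd z))"
      "continuous_on ?S (\<lambda>z. f5 (fst z) (snd z))"
    unfolding q_def q'_def f1_def f2_def f5_def by (intro continuous_intros)+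
  have slice: "continuous_on {0..2 * pi} (f t)"
    if "continuous_on ?S (\<lambda>z. f (fst z) (snd z))" "t \<in> {t0..t1}" for f :: "real \<Rightarrow> real \<Rightarrow> real" and t
    by (rule continuous_on_subset[OF continuous_on_slice_snd[OF that]]) simp
  have Q_deriv: "(Q has_real_derivative Q' t) (at t within {t0..t1})" if t: "t \<in> {t0..t1}" for t
  proof -
    have "((\<lambda>t. integral {0..2 * pi} (q t)) has_real_derivative integral {0..2 * pi} (q' t)) (at t within {t0..t1})"
    proof (rule has_real_derivative_integral_param)
      fix s u :: real assume s: "s \<in> {t0..t1}"
      have "((\<lambda>s. W s u \<bullet> (\<i> * cu s u)) has_real_derivative
          W s u \<bullet> (\<i> * ctu s u) + Wt s u \<bullet> (\<i> * cu s u)) (at s within {t0..t1})"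
        by (rule has_real_derivative_inner[OF W_t[OF s] has_vector_derivative_mult_right[OF cu_t[OF s]]])
      from DERIV_mult[OF a_t[OF s, of u] this]
      show "((\<lambda>s. q s u) has_real_derivative q' s u) (at s within {t0..t1})"
        by (simp add: q_def q'_def algebra_simps)
    next
      show "continuous_on ({t0..t1} \<times> {0..2 * pi}) (\<lambda>z. q' (fst z) (snd z))"
        by (rule continuous_on_subset[OF conts(2)]) auto
    qed (use t slice[OF conts(1)] in auto)
    moreover have "((\<lambda>t. \<phi> (len t)) has_real_derivative \<phi>' (len t) * (- int_ak t)) (at t within {t0..t1})"
      by (rule DERIV_chain2[OF \<phi>_deriv[OF len_pos[OF t]] len_t[OF t]])
    ultimately show ?thesis
      unfolding Q_def Q'_def by (auto intro!: derivative_eq_intros)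
  qed
  have Q'_int: "(Q' has_integral 0) {t0..t1}"
  proof -
    have "(Q' has_integral Q t1 - Q t0) {t0..t1}"
      using t0_less Q_deriv
      by (intro fundamental_theorem_of_calculus) (auto simp: has_real_derivative_iff_has_vector_derivative)
    moreover have "q t0 = (\<lambda>u. 0)" "q t1 = (\<lambda>u. 0)" by (simp_all add: fun_eq_iff q_def W_end)
    then have "Q t0 = 0" "Q t1 = 0" by (simp_all add: Q_def)
    ultimately show ?thesis by simp
  qed
  have "continuous_on {t0..t1} ?X"
    using continuous_on_mult[OF cont_\<phi>_len continuous_on_integral_param[OF conts(5)]]
    unfolding f5_def .
  then have X_int: "(?X has_integral integral {t0..t1} ?X) {t0..t1}"
    by (intro integrable_integral integrable_continuous_interval)
  have "?I t = ?X t + Q' t" if t: "t \<in> {t0..t1}" for t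
  proof -
    define ph where "ph = \<phi> (len t)"
    define ph' where "ph' = \<phi>' (len t)"
    define K where "K = int_a2 t"
    define L where "L = int_ak t"
    have ph: "ph > 0" unfolding ph_def by (intro \<phi>_pos len_pos t)
    \<comment> \<open>At a fixed time, the factors that do not depend on \<open>u\<close> can be moved into the
      integrals.  Then \<open>?I t - Q' t - ?X t\<close> is the integral of \<open>E\<close>, which is the
      derivative of \<open>D\<close>.\<close>
    define D where "D u = 1 / 2 * (ph' * K + ph * (a t u)\<^sup>2) * (W t u \<bullet> tang t u)" for u
    define E where "E u = 1 / 2 * ph' * K * f1 t u + 1 / 2 * ph * f2 t u + ph' * L * q t u
        - ph * q' t u - ph * f5 t u" for u
    have I1: "(E has_integral 1 / 2 * ph' * K * integral {0..2 * pi} (f1 t) + 1 / 2 * ph * integral {0..2 * pi} (f2 t)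
        + ph' * L * integral {0..2 * pi} (q t) - ph * integral {0..2 * pi} (q' t)
        - ph * integral {0..2 * pi} (f5 t)) {0..2 * pi}"
      unfolding E_def
      by (intro has_integral_add has_integral_diff has_integral_mult_right integrable_integral
          integrable_continuous_interval slice[OF _ t] conts)
    have I2: "(E has_integral D (2 * pi) - D 0) {0..2 * pi}"
    proof (rule fundamental_theorem_of_calculus)
      fix u :: real
      have WT: "((\<lambda>u. W t u \<bullet> tang t u) has_real_derivative
          W t u \<bullet> (of_real (curv t u) * (\<i> * cu t u)) + Wu t u \<bullet> tang t u) (at u)"
        by (rule has_real_derivative_inner[OF W_u[OF t] tang_u[OF t]])
      have "(D has_real_derivative ph * (a t u * a_prime t u) * (W t u \<bullet> tang t u) +
         1 / 2 * (ph' * K + ph * (a t u)\<^sup>2) *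
         (W t u \<bullet> (of_real (curv t u) * (\<i> * cu t u)) + Wu t u \<bullet> tang t u)) (at u)"
        unfolding D_def by (rule derivative_eq_intros a_u[OF t] WT refl)+ (simp add: algebra_simps)
      moreover have "ph * (a t u * a_prime t u) * (W t u \<bullet> tang t u) +
         1 / 2 * (ph' * K + ph * (a t u)\<^sup>2) *
         (W t u \<bullet> (of_real (curv t u) * (\<i> * cu t u)) + Wu t u \<bullet> tang t u) = E u"
      proof -
        have 1: "W t u \<bullet> (of_real (curv t u) * (\<i> * cu t u)) = curv t u * (W t u \<bullet> (\<i> * cu t u))"
          by (simp add: inner_complex_def algebra_simps)
        have 2: "W t u \<bullet> (\<i> * ctu t u) = - a t u * curv t u * (W t u \<bullet> (\<i> * cu t u)) - a_prime t u * (W t u \<bullet> tang t u)"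
          unfolding ii_ctu[OF t] by (simp add: inner_complex_def algebra_simps)
        have 3: "(ct t u \<bullet> Wt t u) * norm (cu t u) = a t u * (Wt t u \<bullet> (\<i> * cu t u))"
        proof -
          have *: "Wt t u \<bullet> (\<i> * cu t u) = Wt t u \<bullet> (\<i> * (of_real (norm (cu t u)) * tang t u))"
            by (subst (1) cu_eq[OF t, of u]) (rule refl)
          show ?thesis unfolding * by (simp add: ct_eq[OF t] inner_complex_def algebra_simps)
        qed
        have 4: "ct t u \<bullet> ct t u = (a t u)\<^sup>2"
          by (rule ct_ct[OF t])
        have 5: "ph * geodesic_rhs t u = curv t u / 2 * (ph * (a t u)\<^sup>2 - ph' * K) + ph' * a t u * L"
          using ph unfolding geodesic_rhs_def K_def L_def ph_def[symmetric] ph'_def[symmetric]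
          by (simp add: field_simps)
        have 6: "ph * f5 t u = (W t u \<bullet> (\<i> * cu t u)) * (ph * geodesic_rhs t u - ph * a_dot t u)"
          unfolding f5_def by (simp add: algebra_simps)
        show ?thesis
          unfolding E_def 6 5 f1_def f2_def q_def q'_def 1 2 4 mult.assoc[of 2] 3
          by (simp add: field_simps power2_eq_square)
      qed
      ultimately show "(D has_vector_derivative E u) (at u within {0..2 * pi})"
        by (simp add: has_real_derivative_iff_has_vector_derivative has_vector_derivative_at_within)
    qed simp
    have D0: "D (2 * pi) = D 0"
      using W_per[OF t, of 0] a_periodic[OF t, of 0] tang_periodic[OF t, of 0] by (simp add: D_def)
    have E0: "1 / 2 * ph' * K * integral {0..2 * pi} (f1 t) + 1 / 2 * ph * integral {0..2 * pi} (f2 t)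
        + ph' * L * integral {0..2 * pi} (q t) - ph * integral {0..2 * pi} (q' t)
        - ph * integral {0..2 * pi} (f5 t) = 0"
      using has_integral_unique[OF I1 I2] unfolding D0 diff_self .
    have K: "integral {0..2 * pi} (\<lambda>u. (ct t u \<bullet> ct t u) * norm (cu t u)) = K"
      by (simp add: K_def int_a2_def ct_ct[OF t])
    have "?I t = 1 / 2 * (ph' * integral {0..2 * pi} (f1 t) * K + ph * integral {0..2 * pi} (f2 t))"
      unfolding K f1_def[abs_def] f2_def[abs_def] ph_def ph'_def by (rule refl)
    also have "\<dots> = ph * integral {0..2 * pi} (f5 t) + Q' t"
      using E0 unfolding Q'_def ph_def[symmetric] ph'_def[symmetric] L_def[symmetric]
      by (simp add: algebra_simps)
    also have "ph * integral {0..2 * pi} (f5 t) = ?X t"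
      unfolding f5_def[abs_def] ph_def by (rule refl)
    finally show ?thesis .
  qed
  moreover have "((\<lambda>t. ?X t + Q' t) has_integral integral {t0..t1} ?X + 0) {t0..t1}"
    by (rule has_integral_add[OF X_int Q'_int])
  ultimately have "(?I has_integral integral {t0..t1} ?X + 0) {t0..t1}"
    by (subst has_integral_cong) auto
  then show ?thesis unfolding add_0_right by (rule integral_unique)
qed

end

section \<open>Differentiating the energy along a variation\<close>

text \<open>Differentiation under the integral twice: first the length and the kinetic integral for each
  fixed time, then the integral over time.  The second step needs the derivatives found in the
  first to be jointly continuous in the variation parameter and time.\<close>
lemma energy_has_derivative:
  fixes Vt Vu Vts Vus :: "real \<Rightarrow> real \<Rightarrow> real \<Rightarrow> complex"
  assumes "\<epsilon> > 0"
    and vel: "\<And>s t u. s \<in> {-\<epsilon><..<\<epsilon>} \<Longrightarrow> t \<in> {t0..t1} \<Longrightarrow> velocity t0 t1 (V s) t u = Vt s t u"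
    and tan: "\<And>s t u. s \<in> {-\<epsilon><..<\<epsilon>} \<Longrightarrow> t \<in> {t0..t1} \<Longrightarrow> vector_derivative (V s t) (at u) = Vu s t u"
    and Vts: "\<And>s t u. s \<in> {-\<epsilon><..<\<epsilon>} \<Longrightarrow> t \<in> {t0..t1} \<Longrightarrow>
        ((\<lambda>s. Vt s t u) has_vector_derivative Vts s t u) (at s within {-\<epsilon><..<\<epsilon>})"
    and Vus: "\<And>s t u. s \<in> {-\<epsilon><..<\<epsilon>} \<Longrightarrow> t \<in> {t0..t1} \<Longrightarrow>
        ((\<lambda>s. Vu s t u) has_vector_derivative Vus s t u) (at s within {-\<epsilon><..<\<epsilon>})"
    and nz: "\<And>s t u. s \<in> {-\<epsilon><..<\<epsilon>} \<Longrightarrow> t \<in> {t0..t1} \<Longrightarrow> Vu s t u \<noteq> 0"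
    and cont [continuous_intros]:
      "continuous_on (({-\<epsilon><..<\<epsilon>} \<times> {t0..t1}) \<times> UNIV) (\<lambda>z. Vt (fst (fst z)) (snd (fst z)) (snd z))"
      "continuous_on (({-\<epsilon><..<\<epsilon>} \<times> {t0..t1}) \<times> UNIV) (\<lambda>z. Vu (fst (fst z)) (snd (fst z)) (snd z))"
      "continuous_on (({-\<epsilon><..<\<epsilon>} \<times> {t0..t1}) \<times> UNIV) (\<lambda>z. Vts (fst (fst z)) (snd (fst z)) (snd z))"
      "continuous_on (({-\<epsilon><..<\<epsilon>} \<times> {t0..t1}) \<times> UNIV) (\<lambda>z. Vus (fst (fst z)) (snd (fst z)) (snd z))"
    and \<phi>_deriv: "\<And>l. l > 0 \<Longrightarrow> (\<phi> has_real_derivative \<phi>' l) (at l)"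
    and \<phi>'_cont: "continuous_on {0<..} \<phi>'"
  shows "((\<lambda>s. energy \<phi> t0 t1 (V s)) has_real_derivative
     integral {t0..t1} (\<lambda>t. 1 / 2 *
      (\<phi>' (integral {0..2 * pi} (\<lambda>u. norm (Vu 0 t u))) *
         integral {0..2 * pi} (\<lambda>u. (Vu 0 t u \<bullet> Vus 0 t u) / norm (Vu 0 t u)) *
         integral {0..2 * pi} (\<lambda>u. (Vt 0 t u \<bullet> Vt 0 t u) * norm (Vu 0 t u)) +
       \<phi> (integral {0..2 * pi} (\<lambda>u. norm (Vu 0 t u))) *
         integral {0..2 * pi} (\<lambda>u. 2 * (Vt 0 t u \<bullet> Vts 0 t u) * norm (Vu 0 t u) +
           (Vt 0 t u \<bullet> Vt 0 t u) * ((Vu 0 t u \<bullet> Vus 0 t u) / norm (Vu 0 t u)))))) (at 0)"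
proof -
  let ?I = "{-\<epsilon><..<\<epsilon>}" and ?J = "{t0..t1}"
  define le where "le s t = integral {0..2 * pi} (\<lambda>u. norm (Vu s t u))" for s t
  define le' where "le' s t = integral {0..2 * pi} (\<lambda>u. (Vu s t u \<bullet> Vus s t u) / norm (Vu s t u))" for s t
  define ki where "ki s t = integral {0..2 * pi} (\<lambda>u. (Vt s t u \<bullet> Vt s t u) * norm (Vu s t u))" for s t
  define ki' where "ki' s t = integral {0..2 * pi} (\<lambda>u. 2 * (Vt s t u \<bullet> Vts s t u) * norm (Vu s t u) +
           (Vt s t u \<bullet> Vt s t u) * ((Vu s t u \<bullet> Vus s t u) / norm (Vu s t u)))" for s t
  have c_n: "continuous_on ((?I \<times> ?J) \<times> UNIV) (\<lambda>z. norm (Vu (fst (fst z)) (snd (fst z)) (snd z)))"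
    and c_n': "continuous_on ((?I \<times> ?J) \<times> UNIV) (\<lambda>z. (Vu (fst (fst z)) (snd (fst z)) (snd z) \<bullet>
      Vus (fst (fst z)) (snd (fst z)) (snd z)) / norm (Vu (fst (fst z)) (snd (fst z)) (snd z)))"
    and c_k: "continuous_on ((?I \<times> ?J) \<times> UNIV) (\<lambda>z. (Vt (fst (fst z)) (snd (fst z)) (snd z) \<bullet>
      Vt (fst (fst z)) (snd (fst z)) (snd z)) * norm (Vu (fst (fst z)) (snd (fst z)) (snd z)))"
    and c_k': "continuous_on ((?I \<times> ?J) \<times> UNIV) (\<lambda>z. 2 * (Vt (fst (fst z)) (snd (fst z)) (snd z) \<bullet>
      Vts (fst (fst z)) (snd (fst z)) (snd z)) * norm (Vu (fst (fst z)) (snd (fst z)) (snd z)) +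
      (Vt (fst (fst z)) (snd (fst z)) (snd z) \<bullet> Vt (fst (fst z)) (snd (fst z)) (snd z)) *
      ((Vu (fst (fst z)) (snd (fst z)) (snd z) \<bullet>
      Vus (fst (fst z)) (snd (fst z)) (snd z)) / norm (Vu (fst (fst z)) (snd (fst z)) (snd z))))"
    using nz by (auto intro!: continuous_intros)
  have slice: "continuous_on {0..2 * pi} (f s t)"
    if "continuous_on ((?I \<times> ?J) \<times> UNIV) (\<lambda>z. f (fst (fst z)) (snd (fst z)) (snd z))"
       "s \<in> ?I" "t \<in> ?J" for f :: "real \<Rightarrow> real \<Rightarrow> real \<Rightarrow> real" and s t
  proof -
    have "continuous_on UNIV ((\<lambda>p. f (fst p) (snd p)) (s, t))"
      by (rule continuous_on_slice_snd[of "?I \<times> ?J"]) (use that in auto)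
    then show ?thesis by (auto intro: continuous_on_subset)
  qed
  have le_pos: "le s t > 0" if "s \<in> ?I" "t \<in> ?J" for s t
  proof -
    have "le s t \<ge> 0" unfolding le_def
      by (intro integral_nonneg integrable_continuous_interval slice[OF c_n that]) auto
    moreover have "le s t \<noteq> 0"
      unfolding le_def using integral_eq_0_iff[OF slice[OF c_n that]] nz[OF that, of 0] by auto
    ultimately show ?thesis by simp
  qed
  have cont_le: "continuous_on (?I \<times> ?J) (\<lambda>p. le (fst p) (snd p))"
    and cont_le': "continuous_on (?I \<times> ?J) (\<lambda>p. le' (fst p) (snd p))"
    and cont_ki: "continuous_on (?I \<times> ?J) (\<lambda>p. ki (fst p) (snd p))"
    and cont_ki': "continuous_on (?I \<times> ?J) (\<lambda>p. ki' (fst p) (snd p))"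
    unfolding le_def le'_def ki_def ki'_def
    by (intro continuous_on_integral_param c_n c_n' c_k c_k')+
  have cont_\<phi>: "continuous_on (?I \<times> ?J) (\<lambda>p. \<phi> (le (fst p) (snd p)))"
  proof (rule continuous_on_compose2[OF _ cont_le])
    show "continuous_on {0<..} \<phi>"
      by (intro continuous_at_imp_continuous_on ballI DERIV_isCont[OF \<phi>_deriv]) auto
  qed (use le_pos in auto)
  have cont_\<phi>': "continuous_on (?I \<times> ?J) (\<lambda>p. \<phi>' (le (fst p) (snd p)))"
    by (rule continuous_on_compose2[OF \<phi>'_cont cont_le]) (use le_pos in auto)
  have norm_deriv: "((\<lambda>s. norm (Vu s t u)) has_real_derivative (Vu s t u \<bullet> Vus s t u) / norm (Vu s t u)) (at s within ?I)"
    if "s \<in> ?I" "t \<in> ?J" for s t u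
    by (rule has_real_derivative_norm[OF Vus[OF that] nz[OF that]])
  have le_deriv: "((\<lambda>s. le s t) has_real_derivative le' s t) (at s within ?I)" if "s \<in> ?I" "t \<in> ?J" for s t
    unfolding le_def le'_def
  proof (rule has_real_derivative_integral_param)
    show "continuous_on (?I \<times> {0..2 * pi})
        (\<lambda>z. (Vu (fst z) t (snd z) \<bullet> Vus (fst z) t (snd z)) / norm (Vu (fst z) t (snd z)))"
      by (rule continuous_on_slice_mid[OF c_n' that(2)])
  qed (use that norm_deriv slice[OF c_n] in auto)
  have ki_deriv: "((\<lambda>s. ki s t) has_real_derivative ki' s t) (at s within ?I)" if "s \<in> ?I" "t \<in> ?J" for s t
    unfolding ki_def ki'_def
  proof (rule has_real_derivative_integral_param)
    show "continuous_on (?I \<times> {0..2 * pi})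
        (\<lambda>z. 2 * (Vt (fst z) t (snd z) \<bullet> Vts (fst z) t (snd z)) * norm (Vu (fst z) t (snd z)) +
           (Vt (fst z) t (snd z) \<bullet> Vt (fst z) t (snd z)) *
           ((Vu (fst z) t (snd z) \<bullet> Vus (fst z) t (snd z)) / norm (Vu (fst z) t (snd z))))"
      by (rule continuous_on_slice_mid[OF c_k' that(2)])
    fix r u :: real assume r: "r \<in> ?I"
    have "((\<lambda>s. Vt s t u \<bullet> Vt s t u) has_real_derivative 2 * (Vt r t u \<bullet> Vts r t u)) (at r within ?I)"
      using has_real_derivative_inner[OF Vts[OF r that(2), of u] Vts[OF r that(2), of u]]
      by (simp add: inner_commute)
    from DERIV_mult[OF this norm_deriv[OF r that(2)]]
    show "((\<lambda>s. (Vt s t u \<bullet> Vt s t u) * norm (Vu s t u)) has_real_derivative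
        2 * (Vt r t u \<bullet> Vts r t u) * norm (Vu r t u) +
           (Vt r t u \<bullet> Vt r t u) * ((Vu r t u \<bullet> Vus r t u) / norm (Vu r t u))) (at r within ?I)"
      by (simp add: add.commute mult.commute)
  qed (use that slice[OF c_k] in auto)
  define g where "g s t = 1 / 2 * (\<phi> (le s t) * ki s t)" for s t
  define g' where "g' s t = 1 / 2 * (\<phi>' (le s t) * le' s t * ki s t + \<phi> (le s t) * ki' s t)" for s t
  have cont_g: "continuous_on (?I \<times> ?J) (\<lambda>p. g (fst p) (snd p))"
    and cont_g': "continuous_on (?I \<times> ?J) (\<lambda>p. g' (fst p) (snd p))"
    unfolding g_def g'_def
    by (intro continuous_on_mult continuous_on_add continuous_on_const cont_\<phi> cont_\<phi>' cont_le' cont_ki cont_ki')+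
  have "((\<lambda>s. integral ?J (g s)) has_real_derivative integral ?J (g' 0)) (at 0 within ?I)"
  proof (rule has_real_derivative_integral_param)
    fix s t assume s: "s \<in> ?I" and t: "t \<in> ?J"
    have "((\<lambda>s. \<phi> (le s t)) has_real_derivative \<phi>' (le s t) * le' s t) (at s within ?I)"
      by (rule DERIV_chain2[OF \<phi>_deriv[OF le_pos[OF s t]] le_deriv[OF s t]])
    from DERIV_cmult[OF DERIV_mult[OF this ki_deriv[OF s t]], of "1 / 2"]
    show "((\<lambda>s. g s t) has_real_derivative g' s t) (at s within ?I)"
      by (simp add: g_def g'_def algebra_simps)
  next
    show "continuous_on ?J (g s)" if "s \<in> ?I" for s
      by (rule continuous_on_slice_snd[OF cont_g that])
  qed (use \<open>\<epsilon> > 0\<close> cont_g' in auto)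
  then have "((\<lambda>s. integral ?J (g s)) has_real_derivative integral ?J (g' 0)) (at 0)"
    using \<open>\<epsilon> > 0\<close> by (simp add: at_within_open[of 0 ?I])
  then have "((\<lambda>s. energy \<phi> t0 t1 (V s)) has_real_derivative integral ?J (g' 0)) (at 0)"
  proof (rule has_field_derivative_transform_within_open)
    fix s assume s: "s \<in> ?I"
    have "integral ?J (\<lambda>t. metric \<phi> (V s t) (velocity t0 t1 (V s) t) (velocity t0 t1 (V s) t))
        = integral ?J (\<lambda>t. \<phi> (le s t) * ki s t)"
      by (rule integral_cong)
        (simp add: metric_def curve_length_def circle_integral_def speed_def[abs_def] vel[OF s] tan[OF s] le_def ki_def)
    then show "integral ?J (g s) = energy \<phi> t0 t1 (V s)"
      by (simp add: energy_def g_def[abs_def])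
  qed (use \<open>\<epsilon> > 0\<close> in auto)
  then show ?thesis unfolding g'_def[abs_def] le_def le'_def ki_def ki'_def .
qed

context normal_flow
begin

text \<open>Combines differentiation under the integral with integration by parts.  The first requires
  derivatives of \<open>V\<^sub>t\<close> and \<open>V\<^sub>\<theta>\<close> in the variation parameter, the second derivatives of
  \<open>W = V\<^sub>s\<close> in time and along the curve; they agree as mixed partial derivatives.\<close>
lemma energy_variation:
  assumes \<epsilon>: "\<epsilon> > 0" and V: "smooth_variation t0 t1 c \<epsilon> V"
    and W: "\<And>t u. t \<in> {t0..t1} \<Longrightarrow> ((\<lambda>s. V s t u) has_vector_derivative W t u) (at 0)"
  shows "((\<lambda>s. energy \<phi> t0 t1 (V s)) has_real_derivative
    integral {t0..t1} (\<lambda>t. \<phi> (len t) *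
        integral {0..2 * pi} (\<lambda>u. (W t u \<bullet> (\<i> * cu t u)) * (geodesic_rhs t u - a_dot t u)))) (at 0)"
proof -
  let ?I = "{-\<epsilon><..<\<epsilon>}" and ?J = "{t0..t1}"
  have 0: "(0 :: real) \<in> ?I" using \<epsilon> by simp
  have at_I: "at s within ?I = at s" if "s \<in> ?I" for s by (rule at_within_open[OF that]) simp
  have "Ck_on (Suc (Suc 0)) (?I \<times> ?J \<times> UNIV) (\<lambda>(s, t, u). V s t u)"
    using V unfolding smooth_variation_def smooth_on_def by blast
  then obtain v1 v2 v3 where v: "Ck_on (Suc 0) (?I \<times> ?J \<times> UNIV) v1"
      "Ck_on (Suc 0) (?I \<times> ?J \<times> UNIV) v2" "Ck_on (Suc 0) (?I \<times> ?J \<times> UNIV) v3"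
    and v1: "\<And>s t u. s \<in> ?I \<Longrightarrow> t \<in> ?J \<Longrightarrow> ((\<lambda>s. V s t u) has_vector_derivative v1 (s, t, u)) (at s within ?I)"
    and v2: "\<And>s t u. s \<in> ?I \<Longrightarrow> t \<in> ?J \<Longrightarrow> ((\<lambda>t. V s t u) has_vector_derivative v2 (s, t, u)) (at t within ?J)"
    and v3: "\<And>s t u. s \<in> ?I \<Longrightarrow> t \<in> ?J \<Longrightarrow> (V s t has_vector_derivative v3 (s, t, u)) (at u)"
    by (rule Ck_on_partials3) auto
  obtain v21 where v21: "continuous_on (?I \<times> ?J \<times> UNIV) v21"
    "\<And>s t u. s \<in> ?I \<Longrightarrow> t \<in> ?J \<Longrightarrow> ((\<lambda>s. v2 (s, t, u)) has_vector_derivative v21 (s, t, u)) (at s within ?I)"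
    using v(2) by (rule Ck_on_partials3) auto
  obtain v31 where v31: "continuous_on (?I \<times> ?J \<times> UNIV) v31"
    "\<And>s t u. s \<in> ?I \<Longrightarrow> t \<in> ?J \<Longrightarrow> ((\<lambda>s. v3 (s, t, u)) has_vector_derivative v31 (s, t, u)) (at s within ?I)"
    using v(3) by (rule Ck_on_partials3) auto
  note cont = v(1)[THEN Ck_on_imp_continuous] v(2)[THEN Ck_on_imp_continuous] v(3)[THEN Ck_on_imp_continuous]
  have path: "smooth_Imm_path t0 t1 (V s)" if "s \<in> ?I" for s
    using V that unfolding smooth_variation_def by blast
  have Imm: "V s t \<in> Imm" if "s \<in> ?I" "t \<in> ?J" for s t
    using path[OF that(1)] that(2) unfolding smooth_Imm_path_def by blast
  have V0: "V 0 t = c t" if "t \<in> ?J" for t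
    using V that unfolding smooth_variation_def by blast
  have W_eq: "W t u = v1 (0, t, u)" if "t \<in> ?J" for t u
    using vector_derivative_unique_at[OF W[OF that]] v1[OF 0 that] at_I[OF 0] by metis
  have v2_0: "v2 (0, t, u) = ct t u" if t: "t \<in> ?J" for t u
  proof -
    have "((\<lambda>t. c t u) has_vector_derivative v2 (0, t, u)) (at t within ?J)"
      by (rule has_vector_derivative_transform[OF t _ v2[OF 0 t]]) (simp add: V0)
    then show ?thesis
      using vector_derivative_within_closed_interval[OF t0_less t] c_t[OF t] by metis
  qed
  have v3_0: "v3 (0, t, u) = cu t u" if t: "t \<in> ?J" for t u
    using v3[OF 0 t, of u] c_u[OF t, of u] V0[OF t] vector_derivative_unique_at by metis
  have energy: "((\<lambda>s. energy \<phi> t0 t1 (V s)) has_real_derivative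
     integral {t0..t1} (\<lambda>t. 1 / 2 *
      (\<phi>' (integral {0..2 * pi} (\<lambda>u. norm (v3 (0, t, u)))) *
         integral {0..2 * pi} (\<lambda>u. (v3 (0, t, u) \<bullet> v31 (0, t, u)) / norm (v3 (0, t, u))) *
         integral {0..2 * pi} (\<lambda>u. (v2 (0, t, u) \<bullet> v2 (0, t, u)) * norm (v3 (0, t, u))) +
       \<phi> (integral {0..2 * pi} (\<lambda>u. norm (v3 (0, t, u)))) *
         integral {0..2 * pi} (\<lambda>u. 2 * (v2 (0, t, u) \<bullet> v21 (0, t, u)) * norm (v3 (0, t, u)) +
           (v2 (0, t, u) \<bullet> v2 (0, t, u)) * ((v3 (0, t, u) \<bullet> v31 (0, t, u)) / norm (v3 (0, t, u))))))) (at 0)"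
  proof (rule energy_has_derivative[OF \<epsilon>])
    fix s t u assume s: "s \<in> ?I" and t: "t \<in> ?J"
    show "velocity t0 t1 (V s) t u = v2 (s, t, u)"
      unfolding velocity_def by (rule vector_derivative_within_closed_interval[OF t0_less t v2[OF s t]])
    show tan: "vector_derivative (V s t) (at u) = v3 (s, t, u)"
      by (rule vector_derivative_at[OF v3[OF s t]])
    show "v3 (s, t, u) \<noteq> 0"
      using Imm[OF s t] tan unfolding Imm_def by auto
  qed (use v21 v31 cont \<phi>_deriv \<phi>'_cont in \<open>auto intro: continuous_on_reassoc\<close>)
  have slice0: "continuous_on (?J \<times> UNIV) (\<lambda>z. f (0, fst z, snd z))"
    if "continuous_on (?I \<times> ?J \<times> UNIV) f" for f :: "real \<times> real \<times> real \<Rightarrow> complex"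
    by (rule continuous_on_compose2[OF that]) (use 0 in \<open>auto intro!: continuous_intros\<close>)
  have fv: "integral {t0..t1} (\<lambda>t. 1 / 2 *
      (\<phi>' (len t) * integral {0..2 * pi} (\<lambda>u. v31 (0, t, u) \<bullet> tang t u) *
         integral {0..2 * pi} (\<lambda>u. (ct t u \<bullet> ct t u) * norm (cu t u)) +
       \<phi> (len t) * integral {0..2 * pi} (\<lambda>u. 2 * (ct t u \<bullet> v21 (0, t, u)) * norm (cu t u) +
           (ct t u \<bullet> ct t u) * (v31 (0, t, u) \<bullet> tang t u))))
    = integral {t0..t1} (\<lambda>t. \<phi> (len t) *
        integral {0..2 * pi} (\<lambda>u. (v1 (0, t, u) \<bullet> (\<i> * cu t u)) * (geodesic_rhs t u - a_dot t u)))"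
  proof (rule first_variation)
    fix t u assume t: "t \<in> ?J"
    show "((\<lambda>t. v1 (0, t, u)) has_vector_derivative v21 (0, t, u)) (at t within ?J)"
    proof (rule mixed_partials_commute[of ?I 0 t0 t1 "\<lambda>s t. V s t u" _ "\<lambda>s t. v2 (s, t, u)"
          "\<lambda>s t. v21 (s, t, u)"])
      show "continuous_on ?J (\<lambda>t. v2 (s, t, u))" if "s \<in> ?I" for s
        by (rule continuous_on_compose2[OF cont(2)]) (use that in \<open>auto intro!: continuous_intros\<close>)
      show "continuous_on (?I \<times> ?J) (\<lambda>z. v21 (fst z, snd z, u))"
        by (rule continuous_on_compose2[OF v21(1)]) (auto intro!: continuous_intros)
    qed (use 0 t v1 v2 v21 in \<open>auto simp: at_I\<close>)
    show "((\<lambda>u. v1 (0, t, u)) has_vector_derivative v31 (0, t, u)) (at u)"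
    proof (rule mixed_partials_commute_UNIV[of ?I 0 "\<lambda>s u. V s t u" _ "\<lambda>s u. v3 (s, t, u)"
          "\<lambda>s u. v31 (s, t, u)"])
      show "continuous_on (?I \<times> UNIV) (\<lambda>z. v3 (fst z, t, snd z))"
        by (rule continuous_on_compose2[OF cont(3)]) (use t in \<open>auto intro!: continuous_intros\<close>)
      show "continuous_on (?I \<times> UNIV) (\<lambda>z. v31 (fst z, t, snd z))"
        by (rule continuous_on_compose2[OF v31(1)]) (use t in \<open>auto intro!: continuous_intros\<close>)
    qed (use 0 t v1 v3 v31 in \<open>auto simp: at_I\<close>)
    have "((\<lambda>s. V s t u) has_vector_derivative v1 (0, t, u + 2 * pi)) (at 0 within ?I)"
    proof (rule has_vector_derivative_transform[OF 0 _ v1[OF 0 t]])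
      show "V s t u = V s t (u + 2 * pi)" if "s \<in> ?I" for s
        using Imm[OF that t] unfolding Imm_def by simp
    qed
    then show "v1 (0, t, u + 2 * pi) = v1 (0, t, u)"
      using v1[OF 0 t, of u] at_I[OF 0] vector_derivative_unique_at by metis
  next
    fix u
    have const: "((\<lambda>s. V s t u) has_vector_derivative 0) (at 0 within ?I)"
      if "t \<in> ?J" "\<And>s. s \<in> ?I \<Longrightarrow> V s t = c t" for t
      by (rule has_vector_derivative_transform[OF 0 _ has_vector_derivative_const[of "c t u"]])
        (simp add: that)
    have ends: "V s t0 = c t0" "V s t1 = c t1" if "s \<in> ?I" for s
      using V that unfolding smooth_variation_def by blast+
    have J: "t0 \<in> ?J" "t1 \<in> ?J" using t0_less by auto
    show "v1 (0, t0, u) = 0"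
      using v1[OF 0 J(1), of u] const[OF J(1) ends(1)] at_I[OF 0] vector_derivative_unique_at by metis
    show "v1 (0, t1, u) = 0"
      using v1[OF 0 J(2), of u] const[OF J(2) ends(2)] at_I[OF 0] vector_derivative_unique_at by metis
  qed (intro slice0 cont v21 v31)+
  have tang_inner: "(cu t u \<bullet> w) / norm (cu t u) = w \<bullet> tang t u" for t u w
    by (simp add: tang_def inner_complex_def add_divide_distrib algebra_simps)
  have "integral {t0..t1} (\<lambda>t. \<phi> (len t) *
        integral {0..2 * pi} (\<lambda>u. (W t u \<bullet> (\<i> * cu t u)) * (geodesic_rhs t u - a_dot t u)))
    = integral {t0..t1} (\<lambda>t. \<phi> (len t) *
        integral {0..2 * pi} (\<lambda>u. (v1 (0, t, u) \<bullet> (\<i> * cu t u)) * (geodesic_rhs t u - a_dot t u)))"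
    by (rule integral_cong) (simp add: W_eq)
  also have "\<dots> = integral {t0..t1} (\<lambda>t. 1 / 2 *
      (\<phi>' (integral {0..2 * pi} (\<lambda>u. norm (v3 (0, t, u)))) *
         integral {0..2 * pi} (\<lambda>u. (v3 (0, t, u) \<bullet> v31 (0, t, u)) / norm (v3 (0, t, u))) *
         integral {0..2 * pi} (\<lambda>u. (v2 (0, t, u) \<bullet> v2 (0, t, u)) * norm (v3 (0, t, u))) +
       \<phi> (integral {0..2 * pi} (\<lambda>u. norm (v3 (0, t, u)))) *
         integral {0..2 * pi} (\<lambda>u. 2 * (v2 (0, t, u) \<bullet> v21 (0, t, u)) * norm (v3 (0, t, u)) +
           (v2 (0, t, u) \<bullet> v2 (0, t, u)) * ((v3 (0, t, u) \<bullet> v31 (0, t, u)) / norm (v3 (0, t, u))))))"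
    unfolding fv[symmetric]
    by (rule integral_cong) (simp only: v2_0 v3_0 tang_inner len_def)
  finally show ?thesis using energy by (simp only:)
qed

section \<open>Test variations and the geodesic equation\<close>

text \<open>For small \<open>s\<close> the perturbed curves are still immersed: by compactness, the derivative of the
  perturbation is at most a constant multiple \<open>B\<close> of \<open>|c\<^sub>\<theta>|\<close>.\<close>
lemma test_variation:
  fixes v :: complex
  assumes path: "smooth_Imm_path t0 t1 c"
    and p: "real_polynomial_function p" and q: "real_polynomial_function q"
  defines "W \<equiv> \<lambda>t u. ((t - t0) * (t1 - t) * p t * q (cis u)) *\<^sub>R v"
  obtains \<epsilon> where "\<epsilon> > 0" "smooth_variation t0 t1 c \<epsilon> (\<lambda>s t u. c t u + s *\<^sub>R W t u)"
proof -
  let ?J = "{t0..t1}"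
  define w where "w t = (t - t0) * (t1 - t) * p t" for t
  define h where "h u = q (cis u)" for u
  have W: "W t u = (w t * h u) *\<^sub>R v" for t u by (simp add: W_def w_def h_def)
  have w: "Ck_on k UNIV w" for k
  proof -
    have "Ck_on k UNIV (\<lambda>t. (t + - t0) * (t1 + - t) * p t)"
      by (intro Ck_on_bilinear[OF bounded_bilinear_mult] Ck_on_add Ck_on_const Ck_on_polynomial[OF p]
          Ck_on_bounded_linear bounded_linear_ident bounded_linear_minus)
    then show ?thesis by (simp add: w_def[abs_def])
  qed
  have h: "Ck_on k UNIV h" for k
    unfolding h_def by (rule Ck_on_trig_polynomial[OF q])
  have h_per: "h (u + 2 * pi) = h u" for u
    by (simp add: h_def cis_mult[symmetric])
  obtain h' where h': "continuous_on UNIV h'" "\<And>u. (h has_vector_derivative h' u) (at u)"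
    using Ck_on_partial1[OF h[of "Suc 0"]] by auto
  have h'_per: "h' (u + 2 * pi) = h' u" for u
    by (rule vector_derivative_periodic_unique[OF h_per h'(2) h'(2)])
  have Wu: "(W t has_vector_derivative (w t * h' u) *\<^sub>R v) (at u)" for t u
  proof -
    have "((\<lambda>u. w t * h u) has_vector_derivative w t * h' u) (at u)"
      by (rule has_vector_derivative_mult_right[OF h'(2)])
    from bounded_linear.has_vector_derivative[OF bounded_linear_scaleR_left this, of v]
    show ?thesis unfolding W .
  qed
  \<comment> \<open>The velocity of the perturbed curve cannot vanish while \<open>|s|\<close> is below the
    reciprocal of this ratio.\<close>
  define r where "r t u = norm ((w t * h' u) *\<^sub>R v) / norm (cu t u)" for t u
  have "compact ((\<lambda>z. r (fst z) (snd z)) ` (?J \<times> {0..2 * pi}))"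
  proof (rule compact_continuous_image)
    have "continuous_on (?J \<times> {0..2 * pi}) (\<lambda>z. w (fst z))" "continuous_on (?J \<times> {0..2 * pi}) (\<lambda>z. h' (snd z))"
      by (rule continuous_on_compose2[OF Ck_on_imp_continuous[OF w]], auto intro: continuous_intros)
        (rule continuous_on_compose2[OF h'(1)], auto intro: continuous_intros)
    moreover have "continuous_on (?J \<times> {0..2 * pi}) (\<lambda>z. cu (fst z) (snd z))"
      by (rule continuous_on_subset[OF cont_partials(2)]) auto
    ultimately show "continuous_on (?J \<times> {0..2 * pi}) (\<lambda>z. r (fst z) (snd z))"
      unfolding r_def by (intro continuous_intros) (auto simp: cu_nz)
  qed (auto intro: compact_Times)
  then obtain B where B: "\<And>t u. t \<in> ?J \<Longrightarrow> u \<in> {0..2 * pi} \<Longrightarrow> \<bar>r t u\<bar> \<le> B"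
    by (force dest!: compact_imp_bounded simp: bounded_iff)
  have r_le: "r t u \<le> B" if t: "t \<in> ?J" for t u
  proof -
    have per: "r t (u + 2 * pi) = r t u" for u
      by (simp add: r_def h'_per cu_periodic[OF t])
    define k where "k = \<lfloor>u / (2 * pi)\<rfloor>"
    have "of_int k \<le> u / (2 * pi)" "u / (2 * pi) \<le> of_int k + 1" unfolding k_def by linarith+
    then have "u + of_int (- k) * (2 * pi) \<in> {0..2 * pi}" by (auto simp: field_simps)
    from B[OF t this] show ?thesis using periodic_int[of "r t" "2 * pi" u "- k", OF per] by simp
  qed
  have "B \<ge> 0" using B[of t0 0] t0_less by force
  define \<epsilon> where "\<epsilon> = 1 / (B + 1)"
  have \<epsilon>: "\<epsilon> > 0" using \<open>B \<ge> 0\<close> by (simp add: \<epsilon>_def)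
  define V where "V s t u = c t u + s *\<^sub>R W t u" for s t u
  have V_u: "(V s t has_vector_derivative cu t u + s *\<^sub>R ((w t * h' u) *\<^sub>R v)) (at u)" if "t \<in> ?J" for s t u
    unfolding V_def
    by (intro has_vector_derivative_add c_u that
        bounded_linear.has_vector_derivative[OF bounded_linear_scaleR_right Wu])
  have nz: "cu t u + s *\<^sub>R ((w t * h' u) *\<^sub>R v) \<noteq> 0" if s: "s \<in> {-\<epsilon><..<\<epsilon>}" and t: "t \<in> ?J" for s t u
  proof
    assume "cu t u + s *\<^sub>R ((w t * h' u) *\<^sub>R v) = 0"
    then have "norm (cu t u) = norm (s *\<^sub>R ((w t * h' u) *\<^sub>R v))"
      by (metis add_eq_0_iff norm_minus_cancel)
    also have "\<dots> = \<bar>s\<bar> * r t u * norm (cu t u)"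
      using cu_nz[OF t, of u] by (simp add: r_def abs_mult)
    finally have "\<bar>s\<bar> * r t u = 1" using cu_nz[OF t, of u] by simp
    moreover have "\<bar>s\<bar> * r t u \<le> \<bar>s\<bar> * B" using r_le[OF t] by (intro mult_left_mono) auto
    moreover have "\<bar>s\<bar> * B < 1"
    proof -
      have "\<bar>s\<bar> * B \<le> \<epsilon> * B" using s \<open>B \<ge> 0\<close> by (intro mult_right_mono) auto
      also have "\<dots> < 1" using \<open>B \<ge> 0\<close> by (simp add: \<epsilon>_def)
      finally show ?thesis .
    qed
    ultimately show False by simp
  qed
  have c_smooth: "Ck_on k (?J \<times> UNIV) (\<lambda>(t, u). c t u)" for k
    using path unfolding smooth_Imm_path_def smooth_on_def by blast
  have ct_smooth: "Ck_on k UNIV (c t)" "c t \<in> Imm" if "t \<in> ?J" for k t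
    using path that unfolding smooth_Imm_path_def smooth_on_def Imm_def by blast+
  note Ck_scaleR = Ck_on_bilinear[OF bounded_bilinear_scaleR]
  note Ck_mult = Ck_on_bilinear[OF bounded_bilinear_mult]
  have V_Imm: "V s t \<in> Imm" if "s \<in> {-\<epsilon><..<\<epsilon>}" "t \<in> ?J" for s t
  proof -
    have "Ck_on k UNIV (V s t)" for k
      unfolding V_def[abs_def] W
      by (intro Ck_on_add ct_smooth that Ck_scaleR Ck_mult Ck_on_const h)
    moreover have "V s t (u + 2 * pi) = V s t u" for u
      by (simp add: V_def W h_per periodic[OF that(2)])
    moreover have "vector_derivative (V s t) (at u) \<noteq> 0" for u
      using vector_derivative_at[OF V_u[OF that(2)]] nz[OF that] by metis
    ultimately show ?thesis unfolding Imm_def smooth_on_def by blast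
  qed
  have V_path: "smooth_Imm_path t0 t1 (V s)" if s: "s \<in> {-\<epsilon><..<\<epsilon>}" for s
  proof -
    have "Ck_on k (?J \<times> UNIV) (\<lambda>(t, u). V s t u)" for k
    proof -
      have "Ck_on k (?J \<times> UNIV) (\<lambda>z. (\<lambda>(t, u). c t u) z +
          s *\<^sub>R ((w (fst z) * h (snd z)) *\<^sub>R v))"
        by (intro Ck_on_add c_smooth Ck_scaleR Ck_mult Ck_on_const
            Ck_on_compose_linear[OF bounded_linear_fst w] Ck_on_compose_linear[OF bounded_linear_snd h])
      then show ?thesis by (simp add: V_def W case_prod_unfold)
    qed
    then show ?thesis using V_Imm[OF s] unfolding smooth_Imm_path_def smooth_on_def by blast
  qed
  have V_smooth: "Ck_on k ({-\<epsilon><..<\<epsilon>} \<times> ?J \<times> UNIV) (\<lambda>(s, t, u). V s t u)" for k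
  proof -
    have snd2: "bounded_linear (\<lambda>z :: real \<times> real \<times> real. fst (snd z))"
      "bounded_linear (\<lambda>z :: real \<times> real \<times> real. snd (snd z))"
      by (intro bounded_linear_fst_comp bounded_linear_snd_comp bounded_linear_snd)+
    have "Ck_on k ({-\<epsilon><..<\<epsilon>} \<times> ?J \<times> UNIV) (\<lambda>z. (\<lambda>(t, u). c t u) (0 + snd z))"
      by (rule Ck_on_compose_affine[OF bounded_linear_snd _ c_smooth]) auto
    then have "Ck_on k ({-\<epsilon><..<\<epsilon>} \<times> ?J \<times> UNIV) (\<lambda>z. (\<lambda>(t, u). c t u) (0 + snd z) +
          fst z *\<^sub>R ((w (fst (snd z)) * h (snd (snd z))) *\<^sub>R v))"
      by (intro Ck_on_add Ck_scaleR Ck_mult Ck_on_const Ck_on_bounded_linear[OF bounded_linear_fst]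
          Ck_on_compose_linear[OF snd2(1) w] Ck_on_compose_linear[OF snd2(2) h])
    then show ?thesis by (simp add: V_def W case_prod_unfold)
  qed
  have "smooth_variation t0 t1 c \<epsilon> V"
    unfolding smooth_variation_def smooth_on_def
  proof (intro conjI allI ballI)
    show "Ck_on k ({-\<epsilon><..<\<epsilon>} \<times> ?J \<times> UNIV) (\<lambda>(s, t, u). V s t u)" for k by (rule V_smooth)
    show "smooth_Imm_path t0 t1 (V s)" if "s \<in> {-\<epsilon><..<\<epsilon>}" for s by (rule V_path[OF that])
  qed (simp_all add: V_def[abs_def] W w_def)
  then show thesis using that[OF \<epsilon>] by (simp add: V_def[abs_def])
qed

lemma geodesic_iff_residual:
  assumes path: "smooth_Imm_path t0 t1 c"
  shows "geodesic_in_Imm \<phi> t0 t1 c \<longleftrightarrow> (\<forall>t\<in>{t0..t1}. \<forall>u. geodesic_rhs t u = a_dot t u)"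
proof
  assume eq: "\<forall>t\<in>{t0..t1}. \<forall>u. geodesic_rhs t u = a_dot t u"
  show "geodesic_in_Imm \<phi> t0 t1 c"
    unfolding geodesic_in_Imm_def
  proof (intro conjI path allI impI)
    fix \<epsilon> :: real and V assume \<epsilon>: "\<epsilon> > 0" and V: "smooth_variation t0 t1 c \<epsilon> V"
    have "Ck_on (Suc 0) ({-\<epsilon><..<\<epsilon>} \<times> {t0..t1} \<times> UNIV) (\<lambda>(s, t, u). V s t u)"
      using V unfolding smooth_variation_def smooth_on_def by blast
    then obtain v1 where "\<And>s t u. s \<in> {-\<epsilon><..<\<epsilon>} \<Longrightarrow> t \<in> {t0..t1} \<Longrightarrow>
        ((\<lambda>s. V s t u) has_vector_derivative v1 (s, t, u)) (at s within {-\<epsilon><..<\<epsilon>})"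
      by (rule Ck_on_partials3) auto
    from this[of 0] have "((\<lambda>s. V s t u) has_vector_derivative v1 (0, t, u)) (at 0)" if "t \<in> {t0..t1}" for t u
      using \<epsilon> that by (simp add: at_within_open[of 0 "{-\<epsilon><..<\<epsilon>}"])
    from energy_variation[OF \<epsilon> V this]
    have E: "((\<lambda>s. energy \<phi> t0 t1 (V s)) has_real_derivative
      integral {t0..t1} (\<lambda>t. \<phi> (len t) *
        integral {0..2 * pi} (\<lambda>u. (v1 (0, t, u) \<bullet> (\<i> * cu t u)) * (geodesic_rhs t u - a_dot t u)))) (at 0)" .
    have "integral {t0..t1} (\<lambda>t. \<phi> (len t) *
        integral {0..2 * pi} (\<lambda>u. (v1 (0, t, u) \<bullet> (\<i> * cu t u)) * (geodesic_rhs t u - a_dot t u)))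
        = integral {t0..t1} (\<lambda>t. 0)"
      by (rule integral_cong) (simp add: eq)
    with E show "((\<lambda>s. energy \<phi> t0 t1 (V s)) has_real_derivative 0) (at 0)" by simp
  qed
next
  assume geo: "geodesic_in_Imm \<phi> t0 t1 c"
  have zero: "\<phi> (len t) * (v \<bullet> (\<i> * cu t u)) * (geodesic_rhs t u - a_dot t u) = 0" if t: "t \<in> {t0..t1}" for v t u
  proof (rule fundamental_lemma[OF t0_less _ _ _ t,
      where F = "\<lambda>t u. \<phi> (len t) * (v \<bullet> (\<i> * cu t u)) * (geodesic_rhs t u - a_dot t u)"])
    show "continuous_on ({t0..t1} \<times> UNIV) (\<lambda>z. \<phi> (len (fst z)) * (v \<bullet> (\<i> * cu (fst z) (snd z)))
        * (geodesic_rhs (fst z) (snd z) - a_dot (fst z) (snd z)))"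
      by (intro continuous_intros continuous_on_fst_compose[OF cont_\<phi>_len])
    show "\<phi> (len t) * (v \<bullet> (\<i> * cu t (u + 2 * pi))) * (geodesic_rhs t (u + 2 * pi) - a_dot t (u + 2 * pi))
        = \<phi> (len t) * (v \<bullet> (\<i> * cu t u)) * (geodesic_rhs t u - a_dot t u)" if "t \<in> {t0..t1}" for t u
      by (simp only: residual_periodic[OF that] cu_periodic[OF that])
    fix p :: "real \<Rightarrow> real" and q :: "complex \<Rightarrow> real"
    assume p: "real_polynomial_function p" and q: "real_polynomial_function q"
    define W where "W t u = ((t - t0) * (t1 - t) * p t * q (cis u)) *\<^sub>R v" for t u
    obtain \<epsilon> where \<epsilon>: "\<epsilon> > 0" "smooth_variation t0 t1 c \<epsilon> (\<lambda>s t u. c t u + s *\<^sub>R W t u)"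
      using test_variation[OF path p q, of v] unfolding W_def by blast
    have "((\<lambda>s. energy \<phi> t0 t1 (\<lambda>t u. c t u + s *\<^sub>R W t u)) has_real_derivative
      integral {t0..t1} (\<lambda>t. \<phi> (len t) *
        integral {0..2 * pi} (\<lambda>u. (W t u \<bullet> (\<i> * cu t u)) * (geodesic_rhs t u - a_dot t u)))) (at 0)"
      by (rule energy_variation[OF \<epsilon>]) (auto intro!: derivative_eq_intros)
    moreover have "((\<lambda>s. energy \<phi> t0 t1 (\<lambda>t u. c t u + s *\<^sub>R W t u)) has_real_derivative 0) (at 0)"
      using geo \<epsilon> unfolding geodesic_in_Imm_def by blast
    ultimately have "integral {t0..t1} (\<lambda>t. \<phi> (len t) *
        integral {0..2 * pi} (\<lambda>u. (W t u \<bullet> (\<i> * cu t u)) * (geodesic_rhs t u - a_dot t u))) = 0"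
      by (rule DERIV_unique)
    moreover have "\<phi> (len t) * integral {0..2 * pi} (\<lambda>u. (W t u \<bullet> (\<i> * cu t u)) * (geodesic_rhs t u - a_dot t u))
      = (t - t0) * (t1 - t) * p t * integral {0..2 * pi} (\<lambda>u. q (cis u) *
          (\<phi> (len t) * (v \<bullet> (\<i> * cu t u)) * (geodesic_rhs t u - a_dot t u)))" for t
      unfolding integral_mult_right[symmetric]
      by (rule integral_cong) (simp add: W_def algebra_simps)
    ultimately show "integral {t0..t1} (\<lambda>t. (t - t0) * (t1 - t) * p t * integral {0..2 * pi} (\<lambda>u. q (cis u) *
          (\<phi> (len t) * (v \<bullet> (\<i> * cu t u)) * (geodesic_rhs t u - a_dot t u)))) = 0"
      by simp
  qed
  show "\<forall>t\<in>{t0..t1}. \<forall>u. geodesic_rhs t u = a_dot t u"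
  proof (intro ballI allI)
    fix t u assume t: "t \<in> {t0..t1}"
    \<comment> \<open>The constant vector is chosen for the point at hand: the normal direction there.\<close>
    have "(\<i> * cu t u) \<bullet> (\<i> * cu t u) \<noteq> 0" using cu_nz[OF t] by simp
    then show "geodesic_rhs t u = a_dot t u" using zero[OF t, of "\<i> * cu t u" u] \<phi>_len_nz[OF t] by simp
  qed
qed

lemma speed_eq: "t \<in> {t0..t1} \<Longrightarrow> speed (c t) = (\<lambda>u. norm (cu t u))"
  using vector_derivative_at[OF c_u] by (simp add: fun_eq_iff speed_def)

lemma curve_length_eq: "t \<in> {t0..t1} \<Longrightarrow> curve_length (c t) = len t"
  by (simp add: curve_length_def circle_integral_def len_def speed_eq)

lemma curvature_eq:
  assumes t: "t \<in> {t0..t1}"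
  shows "curvature (c t) u = curv t u"
proof -
  have vd: "vector_derivative (c t) (at u) = cu t u" for u by (rule vector_derivative_at[OF c_u[OF t]])
  then have "unit_tangent (c t) = tang t"
    by (simp add: fun_eq_iff unit_tangent_def speed_def tang_def)
  then have "vector_derivative (unit_tangent (c t)) (at u) = \<i> * of_real (curv t u) * cu t u"
    using vector_derivative_at[OF tang_u[OF t, of u]] by (simp add: algebra_simps)
  then show ?thesis unfolding curvature_def vd using cu_nz[OF t, of u] by auto
qed

lemma represents_geodesic_iff:
  assumes path: "smooth_Imm_path t0 t1 c" and hor: "horizontal t0 t1 c"
  shows "represents_geodesic_in_Bi \<phi> t0 t1 c \<longleftrightarrow>
     (\<forall>t\<in>{t0..t1}. \<forall>\<theta>. ((\<lambda>\<tau>. a \<tau> \<theta>) has_real_derivative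
        curvature (c t) \<theta> / 2 *
          ((a t \<theta>)\<^sup>2 - \<phi>' (curve_length (c t)) / \<phi> (curve_length (c t)) *
             circle_integral (\<lambda>u. (a t u)\<^sup>2 * speed (c t) u)) +
        \<phi>' (curve_length (c t)) / \<phi> (curve_length (c t)) * a t \<theta> *
          circle_integral (\<lambda>u. a t u * curvature (c t) u * speed (c t) u)) (at t within {t0..t1}))"
proof -
  have "((\<lambda>\<tau>. a \<tau> u) has_real_derivative geodesic_rhs t u) (at t within {t0..t1}) \<longleftrightarrow> geodesic_rhs t u = a_dot t u"
    if t: "t \<in> {t0..t1}" for t u
    using a_t[OF t, of u] vector_derivative_within_closed_interval[OF t0_less t]
    unfolding has_real_derivative_iff_has_vector_derivative by metis
  then show ?thesis
    using geodesic_iff_residual[OF path] hor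
    by (simp add: represents_geodesic_in_Bi_def geodesic_rhs_def curvature_eq curve_length_eq speed_eq
        circle_integral_def int_a2_def int_ak_def)
qed

end

text \<open>The mixed derivative is taken as the time derivative of \<open>c\<^sub>\<theta>\<close>; that it is also the
  derivative of \<open>c\<^sub>t\<close> along the curve is Schwarz' theorem.\<close>
lemma normal_flow_of_path:
  assumes "t0 < t1" and path: "smooth_Imm_path t0 t1 c"
    and normal: "\<forall>t\<in>{t0..t1}. \<forall>\<theta>. velocity t0 t1 c t \<theta> = \<i> * of_real (a t \<theta>) * unit_tangent (c t) \<theta>"
    and \<phi>: "smooth_on {0<..} \<phi>" "\<forall>l>0. \<phi> l > 0"
  obtains ct cu ctt ctu cuu where "normal_flow t0 t1 c ct cu ctt ctu cuu a \<phi> (deriv \<phi>)"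
proof -
  let ?J = "{t0..t1}"
  have "Ck_on (Suc (Suc 0)) (?J \<times> UNIV) (\<lambda>(t, u). c t u)"
    using path unfolding smooth_Imm_path_def smooth_on_def by blast
  then obtain c1 c2 where c: "Ck_on (Suc 0) (?J \<times> UNIV) c1" "Ck_on (Suc 0) (?J \<times> UNIV) c2"
    and c1: "\<And>t u. t \<in> ?J \<Longrightarrow> ((\<lambda>t. c t u) has_vector_derivative c1 (t, u)) (at t within ?J)"
    and c2: "\<And>t u. t \<in> ?J \<Longrightarrow> (c t has_vector_derivative c2 (t, u)) (at u)"
    by (rule Ck_on_partials2) auto
  obtain c11 c12 where c11: "Ck_on 0 (?J \<times> UNIV) c11" "Ck_on 0 (?J \<times> UNIV) c12"
    "\<And>t u. t \<in> ?J \<Longrightarrow> u \<in> UNIV \<Longrightarrow> ((\<lambda>t. c1 (t, u)) has_vector_derivative c11 (t, u)) (at t within ?J)"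
    "\<And>t u. t \<in> ?J \<Longrightarrow> u \<in> UNIV \<Longrightarrow> ((\<lambda>u. c1 (t, u)) has_vector_derivative c12 (t, u)) (at u)"
    using c(1) by (rule Ck_on_partials2) (rule that)
  obtain c21 c22 where c21: "Ck_on 0 (?J \<times> UNIV) c21" "Ck_on 0 (?J \<times> UNIV) c22"
    "\<And>t u. t \<in> ?J \<Longrightarrow> u \<in> UNIV \<Longrightarrow> ((\<lambda>t. c2 (t, u)) has_vector_derivative c21 (t, u)) (at t within ?J)"
    "\<And>t u. t \<in> ?J \<Longrightarrow> u \<in> UNIV \<Longrightarrow> ((\<lambda>u. c2 (t, u)) has_vector_derivative c22 (t, u)) (at u)"
    using c(2) by (rule Ck_on_partials2) (rule that)
  note cont = c(1)[THEN Ck_on_imp_continuous] c(2)[THEN Ck_on_imp_continuous]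
  have c12: "((\<lambda>u. c1 (t, u)) has_vector_derivative c21 (t, u)) (at u)" if t: "t \<in> ?J" for t u
  proof (rule mixed_partials_commute_UNIV[of ?J t c _ "\<lambda>t u. c2 (t, u)" "\<lambda>t u. c21 (t, u)"])
    show "at t within ?J \<noteq> bot"
      using islimpt_Icc[OF \<open>t0 < t1\<close>] t by (simp add: trivial_limit_within)
  qed (use t c1 c2 c21 cont in auto)
  have vd: "vector_derivative (c t) (at u) = c2 (t, u)" if "t \<in> ?J" for t u
    by (rule vector_derivative_at[OF c2[OF that]])
  have Imm: "c t \<in> Imm" if "t \<in> ?J" for t using path that unfolding smooth_Imm_path_def by blast
  obtain \<phi>1 where \<phi>1: "continuous_on {0<..} \<phi>1"
    "\<And>l. l \<in> {0<..} \<Longrightarrow> (\<phi> has_vector_derivative \<phi>1 l) (at l within {0<..})"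
    using Ck_on_partial1[of 0 "{0<..}" \<phi>] \<phi>(1) unfolding smooth_on_def by (metis Ck_on.simps(1))
  have \<phi>_deriv: "(\<phi> has_real_derivative deriv \<phi> l) (at l)" "deriv \<phi> l = \<phi>1 l" if "l > 0" for l
  proof -
    have "(\<phi> has_real_derivative \<phi>1 l) (at l)"
      using \<phi>1(2)[of l] that
      by (simp add: has_real_derivative_iff_has_vector_derivative at_within_open[of l "{0<..}"])
    then show "(\<phi> has_real_derivative deriv \<phi> l) (at l)" "deriv \<phi> l = \<phi>1 l"
      using DERIV_imp_deriv by force+
  qed
  have "normal_flow t0 t1 c (\<lambda>t u. c1 (t, u)) (\<lambda>t u. c2 (t, u)) (\<lambda>t u. c11 (t, u))
      (\<lambda>t u. c21 (t, u)) (\<lambda>t u. c22 (t, u)) a \<phi> (deriv \<phi>)"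
  proof
    fix t u assume t: "t \<in> ?J"
    show "c2 (t, u) \<noteq> 0" "c t (u + 2 * pi) = c t u"
      using Imm[OF t] vd[OF t] unfolding Imm_def by auto
    have "velocity t0 t1 c t u = c1 (t, u)"
      unfolding velocity_def by (rule vector_derivative_within_closed_interval[OF \<open>t0 < t1\<close> t c1[OF t]])
    then show "c1 (t, u) = \<i> * of_real (a t u) * (c2 (t, u) / of_real (norm (c2 (t, u))))"
      using normal t by (simp add: unit_tangent_def speed_def vd[OF t])
  next
    show "continuous_on {0<..} (deriv \<phi>)"
      by (rule continuous_on_eq[OF \<phi>1(1)]) (simp add: \<phi>_deriv(2))
  qed (use assms(1) c1 c2 c11 c12 c21 cont \<phi> \<phi>_deriv(1) in auto)
  then show thesis by (rule that)
qed

theorem mainTheorem6: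
  fixes t0 t1 :: real
    and c :: "real \<Rightarrow> real \<Rightarrow> complex"
    and a :: "real \<Rightarrow> real \<Rightarrow> real"
  assumes "t0 < t1"
    and "smooth_Imm_path t0 t1 c"
    and "horizontal t0 t1 c"
    and "\<forall>t\<in>{t0..t1}. \<forall>\<theta>. velocity t0 t1 c t \<theta> = \<i> * of_real (a t \<theta>) * unit_tangent (c t) \<theta>"
  shows
    "(\<forall>\<phi> :: real \<Rightarrow> real. smooth_on {0<..} \<phi> \<and> (\<forall>l>0. \<phi> l > 0) \<longrightarrow>
        (represents_geodesic_in_Bi \<phi> t0 t1 c \<longleftrightarrow>
         (\<forall>t\<in>{t0..t1}. \<forall>\<theta>.
            ((\<lambda>\<tau>. a \<tau> \<theta>) has_real_derivative
              curvature (c t) \<theta> / 2 *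
                ((a t \<theta>)\<^sup>2 - deriv \<phi> (curve_length (c t)) / \<phi> (curve_length (c t)) *
                   circle_integral (\<lambda>u. (a t u)\<^sup>2 * speed (c t) u)) +
              deriv \<phi> (curve_length (c t)) / \<phi> (curve_length (c t)) * a t \<theta> *
                circle_integral (\<lambda>u. a t u * curvature (c t) u * speed (c t) u))
            (at t within {t0..t1}))))
   \<and> (represents_geodesic_in_Bi (\<lambda>l. l) t0 t1 c \<longleftrightarrow>
        (\<forall>t\<in>{t0..t1}. \<forall>\<theta>.
            ((\<lambda>\<tau>. a \<tau> \<theta>) has_real_derivative
              curvature (c t) \<theta> / 2 * ((a t \<theta>)\<^sup>2 - average (c t) (\<lambda>u. (a t u)\<^sup>2)) +
              a t \<theta> * average (c t) (\<lambda>u. a t u * curvature (c t) u))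
            (at t within {t0..t1})))
   \<and> (\<forall>A>0. represents_geodesic_in_Bi (\<lambda>l. exp (A * l)) t0 t1 c \<longleftrightarrow>
        (\<forall>t\<in>{t0..t1}. \<forall>\<theta>.
            ((\<lambda>\<tau>. a \<tau> \<theta>) has_real_derivative
              curvature (c t) \<theta> / 2 *
                ((a t \<theta>)\<^sup>2 - (A * curve_length (c t)) * average (c t) (\<lambda>u. (a t u)\<^sup>2)) +
              (A * curve_length (c t)) * a t \<theta> * average (c t) (\<lambda>u. a t u * curvature (c t) u))
            (at t within {t0..t1})))"
    (is "?general \<and> ?linear \<and> ?exponential")
proof -
  have general: "represents_geodesic_in_Bi \<phi> t0 t1 c \<longleftrightarrow>
         (\<forall>t\<in>{t0..t1}. \<forall>\<theta>.
            ((\<lambda>\<tau>. a \<tau> \<theta>) has_real_derivative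
              curvature (c t) \<theta> / 2 *
                ((a t \<theta>)\<^sup>2 - deriv \<phi> (curve_length (c t)) / \<phi> (curve_length (c t)) *
                   circle_integral (\<lambda>u. (a t u)\<^sup>2 * speed (c t) u)) +
              deriv \<phi> (curve_length (c t)) / \<phi> (curve_length (c t)) * a t \<theta> *
                circle_integral (\<lambda>u. a t u * curvature (c t) u * speed (c t) u))
            (at t within {t0..t1}))"
    if \<phi>: "smooth_on {0<..} \<phi>" "\<forall>l>0. \<phi> l > 0" for \<phi>
  proof -
    obtain ct cu ctt ctu cuu where "normal_flow t0 t1 c ct cu ctt ctu cuu a \<phi> (deriv \<phi>)"
      using normal_flow_of_path[OF assms(1,2,4) \<phi>] .
    then show ?thesis
      by (rule normal_flow.represents_geodesic_iff[OF _ assms(2,3)])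
  qed
  have id: "smooth_on {0<..} (\<lambda>l :: real. l)" "\<forall>l>0. (l :: real) > 0"
    by (auto simp: smooth_on_def intro: Ck_on_bounded_linear)
  have exp: "smooth_on {0<..} (\<lambda>l :: real. exp (A * l))" "\<forall>l>0. exp (A * l) > 0" for A :: real
    using Ck_on_exp[of _ "{0<..}" 1 A] by (auto simp: smooth_on_def)
  have deriv_exp: "deriv (\<lambda>l. exp (A * l)) l = A * exp (A * l)" for A l :: real
    by (rule DERIV_imp_deriv) (auto intro!: derivative_eq_intros)
  have len: "curve_length (c t) \<noteq> 0" if "t \<in> {t0..t1}" for t
  proof -
    obtain ct cu ctt ctu cuu where "normal_flow t0 t1 c ct cu ctt ctu cuu a (\<lambda>l. l) (deriv (\<lambda>l. l))"
      using normal_flow_of_path[OF assms(1,2,4) id] .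
    then interpret normal_flow t0 t1 c ct cu ctt ctu cuu a "\<lambda>l. l" "deriv (\<lambda>l. l)" .
    show ?thesis using len_pos[OF that] by (simp add: curve_length_eq[OF that])
  qed
  have ?general using general by blast
  moreover have ?linear
    unfolding general[OF id] by (intro ball_cong refl) (simp add: average_def mult.commute)
  moreover have ?exponential
    unfolding general[OF exp] deriv_exp
    by (intro allI impI ball_cong refl) (simp add: average_def len mult.assoc)
  ultimately show ?thesis by blast
qed

end
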